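(* Let $\mathcal{H}$ be an infinite-dimensional separable complex Hilbert space. If $T\in\mathcal{B}(\mathcal{H})$ is complex symmetric, then $T$ is approximately unitarily equivalent to a reducible complex symmetric operator.
   Context: $\mathcal{B}(\mathcal{H})$ is the algebra of bounded linear operators on $\mathcal{H}$. A conjugation on $\mathcal{H}$ is a conjugate-linear map $C:\mathcal{H}\to\mathcal{H}$ that is invertible with $C^{-1}=C$ and satisfies $\langle Cx,Cy\rangle=\langle y,x\rangle$ for all $x,y\in\mathcal{H}$. An operator $T\in\mathcal{B}(\mathcal{H})$ is complex symmetric if there is a conjugation $C$ on $\mathcal{H}$ with $CTC=T^*$. An operator is reducible if it commutes with some (orthogonal) projection other than $0$ and $I$. Two operators $A,B\in\mathcal{B}(\mathcal{H})$ are approximately unitarily equivalent if there is a sequence $(U_n)_{n\ge1}$ of unitary operators such that $\|U_nA-BU_n\|\to0$ as $n\to\infty$. *)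

theory Defs
  imports "HOL-Analysis.Analysis"
begin

text \<open>A complex inner product space is a real inner product space, with the real part of the
  complex inner product as real inner product; norm and topology are thereby those of
  \<^class>\<open>real_inner\<close>. The complex inner product is linear in the first argument.\<close>

class complex_inner = real_inner +
  fixes scaleC :: "complex \<Rightarrow> 'a \<Rightarrow> 'a" (infixr "*\<^sub>C" 75)
    and cinner :: "'a \<Rightarrow> 'a \<Rightarrow> complex"
  assumes scaleC_add_right: "a *\<^sub>C (x + y) = a *\<^sub>C x + a *\<^sub>C y"
    and scaleC_add_left: "(a + b) *\<^sub>C x = a *\<^sub>C x + b *\<^sub>C x"
    and scaleC_scaleC: "a *\<^sub>C (b *\<^sub>C x) = (a * b) *\<^sub>C x"
    and scaleC_one: "1 *\<^sub>C x = x"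
    and scaleR_scaleC: "r *\<^sub>R x = complex_of_real r *\<^sub>C x"
    and cinner_commute: "cinner x y = cnj (cinner y x)"
    and cinner_add_left: "cinner (x + y) z = cinner x z + cinner y z"
    and cinner_scaleC_left: "cinner (a *\<^sub>C x) y = a * cinner x y"
    and inner_eq_Re_cinner: "x \<bullet> y = Re (cinner x y)"

lemma cinner_self: "cinner x x = complex_of_real ((norm (x :: 'a::complex_inner))\<^sup>2)"
proof (rule complex_eqI)
  show "Re (cinner x x) = Re (complex_of_real ((norm x)\<^sup>2))"
    by (simp add: power2_norm_eq_inner inner_eq_Re_cinner)
  show "Im (cinner x x) = Im (complex_of_real ((norm x)\<^sup>2))"
    using arg_cong[OF cinner_commute[of x x], of Im] by simp
qed

class chilbert_space = complex_inner + complete_space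

global_interpretation complex_vector: vector_space "scaleC :: complex \<Rightarrow> 'a \<Rightarrow> 'a::complex_inner"
  defines cspan = complex_vector.span
  by unfold_locales (rule scaleC_add_right scaleC_add_left scaleC_scaleC scaleC_one)+

definition bounded_clinear :: "('a::complex_inner \<Rightarrow> 'a) \<Rightarrow> bool" where
  "bounded_clinear T \<longleftrightarrow> bounded_linear T \<and> (\<forall>a x. T (a *\<^sub>C x) = a *\<^sub>C T x)"

text \<open>For a bounded operator on a Hilbert space the adjoint exists by the Riesz representation
  theorem; uniqueness is \<open>cadjoint_eqI\<close> below.\<close>

definition cadjoint :: "('a::complex_inner \<Rightarrow> 'a) \<Rightarrow> 'a \<Rightarrow> 'a" where
  "cadjoint T = (THE S. \<forall>x y. cinner (T x) y = cinner x (S y))"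

lemma cadjoint_eqI:
  fixes T S :: "'a::complex_inner \<Rightarrow> 'a"
  assumes "\<And>x y. cinner (T x) y = cinner x (S y)"
  shows "cadjoint T = S"
  unfolding cadjoint_def
proof (rule the_equality)
  show "\<forall>x y. cinner (T x) y = cinner x (S y)"
    using assms by blast
  fix R assume R: "\<forall>x y. cinner (T x) y = cinner x (R y)"
  have "x \<bullet> R y = x \<bullet> S y" for x y
    using R assms by (metis inner_eq_Re_cinner)
  then show "R = S"
    by (metis ext vector_eq_ldot)
qed

definition conjugation :: "('a::complex_inner \<Rightarrow> 'a) \<Rightarrow> bool" where
  "conjugation C \<longleftrightarrow>
     (\<forall>x y. C (x + y) = C x + C y) \<and> (\<forall>a x. C (a *\<^sub>C x) = cnj a *\<^sub>C C x) \<and>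
     bij C \<and> inv C = C \<and>
     (\<forall>x y. cinner (C x) (C y) = cinner y x)"

definition complex_symmetric :: "('a::complex_inner \<Rightarrow> 'a) \<Rightarrow> bool" where
  "complex_symmetric T \<longleftrightarrow> (\<exists>C. conjugation C \<and> C \<circ> T \<circ> C = cadjoint T)"

definition orthogonal_projection :: "('a::complex_inner \<Rightarrow> 'a) \<Rightarrow> bool" where
  "orthogonal_projection P \<longleftrightarrow> bounded_clinear P \<and> P \<circ> P = P \<and> cadjoint P = P"

definition reducible :: "('a::complex_inner \<Rightarrow> 'a) \<Rightarrow> bool" where
  "reducible T \<longleftrightarrow>
     (\<exists>P. orthogonal_projection P \<and> P \<noteq> (\<lambda>x. 0) \<and> P \<noteq> id \<and> P \<circ> T = T \<circ> P)"

definition unitary :: "('a::complex_inner \<Rightarrow> 'a) \<Rightarrow> bool" where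
  "unitary U \<longleftrightarrow> bounded_clinear U \<and> cadjoint U \<circ> U = id \<and> U \<circ> cadjoint U = id"

definition approx_unitarily_equivalent ::
    "('a::complex_inner \<Rightarrow> 'a) \<Rightarrow> ('a \<Rightarrow> 'a) \<Rightarrow> bool" where
  "approx_unitarily_equivalent A B \<longleftrightarrow>
     (\<exists>U :: nat \<Rightarrow> 'a \<Rightarrow> 'a. (\<forall>n. unitary (U n)) \<and>
        (\<lambda>n. onorm (\<lambda>x. U n (A x) - B (U n x))) \<longlonglongrightarrow> 0)"

end

theory Submission
  imports Defs "HOL-Library.Nat_Bijection" "HOL-Complex_Analysis.Great_Picard"
begin

text \<open>Fix a conjugation \<open>C\<close> with \<open>C T C = T\<^sup>*\<close>. The operator \<open>R\<close> is \<open>T \<oplus> B\<close>, transported to the space itself by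
  two isometries with complementary ranges, where \<open>B\<close> is an infinite multiple \<open>A \<oplus> A \<oplus> \<dots>\<close> of an operator
  \<open>A\<close> that \<open>T\<close> contains approximately, again and again, in far-out parts of the space. That such an \<open>R\<close>
  is approximately unitarily equivalent to \<open>T\<close> is an instance of Voiculescu's theorem; the instance
  needed here has a direct proof in which \<open>C\<close> is carried along, so that \<open>R\<close> is complex symmetric.

  \<^emph>\<open>The operator \<open>A\<close>.\<close> Call \<open>x\<close> real if \<open>C x = x\<close>. Starting from a real unit vector \<open>u\<^sub>0\<close>, choose real
  orthonormal \<open>u\<^sub>1, u\<^sub>2, \<dots>\<close> such that the real and the imaginary part of \<open>T u\<^sub>i\<close> lie in the span of
  \<open>u\<^sub>0, \<dots>, u\<^sub>2\<^sub>i\<^sub>+\<^sub>2\<close>. For real \<open>u\<close> one has \<open>T\<^sup>* u = C T u\<close>, so the adjoint is covered as well, and the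
  matrix of \<open>T\<close> on these vectors is symmetric. A finite list of this kind can be chosen orthogonal to
  any given finite set (\<open>krylov_block_exists\<close>), which yields infinitely many mutually orthogonal lists
  of growing length. Along a subsequence their matrices converge entrywise; the limit is a symmetric
  matrix, bounded by the norm of \<open>T\<close>, and it is the matrix of \<open>A\<close> (\<open>limit_matrix\<close>).

  \<^emph>\<open>Gluing the lists.\<close> No single list carries all of \<open>A\<close>. An isometry \<open>V\<close> with \<open>T V\<close> close to \<open>V B\<close>
  is obtained by averaging: give index \<open>i\<close> a level such that \<open>A\<close> changes levels by at most one, and let
  \<open>V\<close> map the basis vector of index \<open>i\<close> to the normalised sum of the vectors \<open>u\<^sub>i\<close> from \<open>N\<close> consecutive
  lists, the first of which is determined by the level. Windows of neighbouring levels differ only in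
  their two end points, so the sums over windows cancel except for boundary terms of norm
  \<open>O(1 / sqrt N)\<close> (\<open>approximate_intertwiner\<close>).

  \<^emph>\<open>Absorption.\<close> As \<open>B\<close> is equivalent to \<open>B \<oplus> B\<close>, the part of \<open>T\<close> that lives on the range of \<open>V\<close> can be
  doubled, which turns \<open>T\<close> into \<open>T \<oplus> B\<close> up to a multiple of the error (\<open>absorption_unitary\<close>).\<close>

section \<open>Complex inner product spaces and orthonormal families\<close>

lemma cinner_add_right: "cinner x (y + z) = cinner x y + cinner (x :: 'a::complex_inner) z"
  by (metis cinner_commute cinner_add_left complex_cnj_add)

lemma cinner_scaleC_right: "cinner x (a *\<^sub>C y) = cnj a * cinner (x :: 'a::complex_inner) y"
  by (metis cinner_commute cinner_scaleC_left complex_cnj_mult)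

lemma cinner_eq_zero_iff [simp]: "cinner x x = 0 \<longleftrightarrow> x = (0 :: 'a::complex_inner)"
  by (simp add: cinner_self)

lemma norm_scaleC: "norm (a *\<^sub>C x) = cmod a * norm (x :: 'a::complex_inner)"
proof -
  have "complex_of_real ((norm (a *\<^sub>C x))\<^sup>2) = complex_of_real ((cmod a * norm x)\<^sup>2)"
    unfolding power_mult_distrib of_real_mult complex_norm_square[of a] cinner_self[symmetric]
    by (simp add: cinner_scaleC_left cinner_scaleC_right)
  then have "(norm (a *\<^sub>C x))\<^sup>2 = (cmod a * norm x)\<^sup>2"
    using of_real_eq_iff by blast
  then show ?thesis
    by (simp add: power2_eq_iff_nonneg)
qed

text \<open>The real inequality bounds only the real part of \<open>cinner x y\<close>; multiplying \<open>x\<close> by a suitable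
  phase makes the complex inner product real and nonnegative.\<close>
lemma complex_Cauchy_Schwarz: "cmod (cinner x y) \<le> norm x * norm (y :: 'a::complex_inner)"
proof -
  define c where "c = cnj (sgn (cinner x y))"
  have "cinner (c *\<^sub>C x) y = complex_of_real (cmod (cinner x y))"
    using complex_norm_square[of "cinner x y"]
    by (simp add: c_def cinner_scaleC_left sgn_div_norm scaleR_conv_of_real divide_simps
        power2_eq_square mult.commute)
  then have "cmod (cinner x y) = (c *\<^sub>C x) \<bullet> y"
    by (simp add: inner_eq_Re_cinner)
  also have "\<dots> \<le> norm (c *\<^sub>C x) * norm y"
    by (rule norm_cauchy_schwarz)
  also have "\<dots> \<le> norm x * norm y"
    by (auto simp: norm_scaleC c_def norm_sgn intro!: mult_right_mono)
  finally show ?thesis .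
qed

lemma bounded_bilinear_cinner: "bounded_bilinear (cinner :: 'a::complex_inner \<Rightarrow> 'a \<Rightarrow> complex)"
proof
  show "\<exists>K. \<forall>(a::'a) b. norm (cinner a b) \<le> norm a * norm b * K"
    by (rule exI[of _ 1]) (simp add: complex_Cauchy_Schwarz)
qed (simp_all add: cinner_add_left cinner_add_right scaleR_scaleC cinner_scaleC_left
    cinner_scaleC_right scaleR_conv_of_real)

lemma bounded_bilinear_scaleC: "bounded_bilinear (scaleC :: complex \<Rightarrow> 'a::complex_inner \<Rightarrow> 'a)"
proof
  show "\<exists>K. \<forall>a (b::'a). norm (a *\<^sub>C b) \<le> norm a * norm b * K"
    by (rule exI[of _ 1]) (simp add: norm_scaleC)
qed (simp_all add: scaleC_add_left scaleC_add_right scaleR_scaleC scaleC_scaleC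
    scaleR_conv_of_real mult.commute)

interpretation ci: bounded_bilinear "cinner :: 'a::complex_inner \<Rightarrow> 'a \<Rightarrow> complex"
  by (rule bounded_bilinear_cinner)

interpretation sc: bounded_bilinear "scaleC :: complex \<Rightarrow> 'a::complex_inner \<Rightarrow> 'a"
  by (rule bounded_bilinear_scaleC)

lemmas cinner_simps = ci.add_left ci.add_right ci.diff_left ci.diff_right ci.minus_left
  ci.minus_right ci.sum_left ci.sum_right cinner_scaleC_left cinner_scaleC_right
  ci.zero_left ci.zero_right

lemma cinner_ext:
  fixes x y :: "'a::complex_inner"
  assumes "\<And>z. cinner x z = cinner y z"
  shows "x = y"
proof -
  have "cinner (x - y) (x - y) = 0"
    using assms by (simp add: cinner_simps)
  then show ?thesis
    by simp
qed

lemma Pythagoras: "cinner x y = 0 \<Longrightarrow> (norm (x + y :: 'a::complex_inner))\<^sup>2 = (norm x)\<^sup>2 + (norm y)\<^sup>2"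
  unfolding power2_norm_eq_inner inner_left_distrib inner_right_distrib inner_commute[of y x]
  by (simp add: inner_eq_Re_cinner)

lemma Pythagoras_sum:
  fixes f :: "'i \<Rightarrow> 'a::complex_inner"
  assumes "finite F" "\<And>p q. p \<in> F \<Longrightarrow> q \<in> F \<Longrightarrow> p \<noteq> q \<Longrightarrow> cinner (f p) (f q) = 0"
  shows "(norm (\<Sum>p\<in>F. f p))\<^sup>2 = (\<Sum>p\<in>F. (norm (f p))\<^sup>2)"
  using assms
proof (induction F rule: finite_induct)
  case (insert p F)
  have "cinner (f p) (\<Sum>q\<in>F. f q) = 0"
    using insert.hyps by (auto simp: cinner_simps intro!: sum.neutral insert.prems)
  then show ?case
    using insert by (simp add: Pythagoras)
qed simp

definition orthonormal_on :: "'i set \<Rightarrow> ('i \<Rightarrow> 'a::complex_inner) \<Rightarrow> bool" where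
  "orthonormal_on I v \<longleftrightarrow> (\<forall>p\<in>I. \<forall>q\<in>I. cinner (v p) (v q) = (if p = q then 1 else 0))"

lemma orthonormal_on_subset: "orthonormal_on I v \<Longrightarrow> J \<subseteq> I \<Longrightarrow> orthonormal_on J v"
  unfolding orthonormal_on_def by blast

lemma orthonormal_onD:
  "orthonormal_on I v \<Longrightarrow> p \<in> I \<Longrightarrow> q \<in> I \<Longrightarrow> cinner (v p) (v q) = (if p = q then 1 else 0)"
  unfolding orthonormal_on_def by blast

lemma norm_eq_one_iff_cinner: "norm x = 1 \<longleftrightarrow> cinner x x = (1 :: complex)" for x :: "'a::complex_inner"
  unfolding cinner_self of_real_eq_1_iff power2_eq_1_iff using norm_ge_zero[of x] by linarith

lemma orthonormal_on_norm_one: "orthonormal_on I v \<Longrightarrow> p \<in> I \<Longrightarrow> norm (v p) = 1"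
  by (simp add: norm_eq_one_iff_cinner orthonormal_onD)

lemma orthonormal_on_norm_sum:
  fixes v :: "'i \<Rightarrow> 'a::complex_inner"
  assumes "orthonormal_on I v" "finite F" "F \<subseteq> I"
  shows "(norm (\<Sum>p\<in>F. c p *\<^sub>C v p))\<^sup>2 = (\<Sum>p\<in>F. (cmod (c p))\<^sup>2)"
proof -
  have "(norm (\<Sum>p\<in>F. c p *\<^sub>C v p))\<^sup>2 = (\<Sum>p\<in>F. (norm (c p *\<^sub>C v p))\<^sup>2)"
    using assms by (intro Pythagoras_sum) (auto simp: cinner_simps orthonormal_on_def subset_iff)
  also have "\<dots> = (\<Sum>p\<in>F. (cmod (c p))\<^sup>2)"
    using assms by (intro sum.cong) (auto simp: norm_scaleC orthonormal_on_norm_one)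
  finally show ?thesis .
qed

lemma cinner_sum_orthonormal:
  fixes v :: "'i \<Rightarrow> 'a::complex_inner"
  assumes "orthonormal_on I v" "finite F" "F \<subseteq> I" "q \<in> I"
  shows "cinner (\<Sum>p\<in>F. c p *\<^sub>C v p) (v q) = (if q \<in> F then c q else 0)"
proof -
  have "cinner (\<Sum>p\<in>F. c p *\<^sub>C v p) (v q) = (\<Sum>p\<in>F. if p = q then c p else 0)"
    unfolding ci.sum_left
    by (intro sum.cong) (use assms in \<open>auto simp: cinner_simps orthonormal_on_def\<close>)
  then show ?thesis
    using assms by simp
qed

lemma Bessel:
  fixes v :: "'i \<Rightarrow> 'a::complex_inner"
  assumes "orthonormal_on I v" "finite F" "F \<subseteq> I"
  shows "(\<Sum>p\<in>F. (cmod (cinner x (v p)))\<^sup>2) \<le> (norm x)\<^sup>2"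
proof -
  define y where "y = (\<Sum>p\<in>F. cinner x (v p) *\<^sub>C v p)"
  have "cinner (x - y) (v q) = 0" if "q \<in> F" for q
    unfolding ci.diff_left y_def using that assms by (subst cinner_sum_orthonormal[of I]) auto
  then have "cinner (x - y) y = 0"
    unfolding y_def ci.sum_right by (intro sum.neutral) (simp add: cinner_simps)
  then have "(norm x)\<^sup>2 = (norm (x - y))\<^sup>2 + (norm y)\<^sup>2"
    using Pythagoras[of "x - y" y] by simp
  moreover have "(norm y)\<^sup>2 = (\<Sum>p\<in>F. (cmod (cinner x (v p)))\<^sup>2)"
    unfolding y_def by (rule orthonormal_on_norm_sum[OF assms])
  ultimately show ?thesis
    by simp
qed

lemma cspan_orthonormal_expansion:
  fixes v :: "'i \<Rightarrow> 'a::complex_inner"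
  assumes "orthonormal_on F v" "finite F" "x \<in> cspan (v ` F)"
  shows "x = (\<Sum>p\<in>F. cinner x (v p) *\<^sub>C v p)"
  using assms(3)
proof (induction rule: complex_vector.span_induct_alt)
  case (step c y z)
  then obtain q where q: "q \<in> F" "y = v q"
    by blast
  have "(\<Sum>p\<in>F. cinner (v q) (v p) *\<^sub>C v p) = (\<Sum>p\<in>F. if q = p then v p else 0)"
    by (intro sum.cong) (use assms q in \<open>auto simp: orthonormal_onD scaleC_one\<close>)
  then have *: "(\<Sum>p\<in>F. cinner (v q) (v p) *\<^sub>C v p) = v q"
    using q assms by simp
  have "(\<Sum>p\<in>F. cinner (c *\<^sub>C y + z) (v p) *\<^sub>C v p)
      = c *\<^sub>C (\<Sum>p\<in>F. cinner (v q) (v p) *\<^sub>C v p) + (\<Sum>p\<in>F. cinner z (v p) *\<^sub>C v p)"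
    by (simp add: cinner_simps q scaleC_add_left sum.distrib sc.sum_right scaleC_scaleC)
  then show ?case
    using * step q by simp
qed (simp add: ci.zero_left sc.zero_left)

lemma cspan_orthogonal:
  fixes x :: "'a::complex_inner"
  assumes "x \<in> cspan S" "\<And>s. s \<in> S \<Longrightarrow> cinner s y = 0"
  shows "cinner x y = 0"
  using assms(1) by (induction rule: complex_vector.span_induct_alt) (use assms(2) in \<open>auto simp: cinner_simps ci.zero_left\<close>)

lemma cinner_eq_0_commute: "cinner x y = 0 \<Longrightarrow> cinner y (x :: 'a::complex_inner) = 0"
  by (metis cinner_commute complex_cnj_zero)

lemma sum_scaleC_in_cspan:
  "E \<subseteq> E' \<Longrightarrow> (\<Sum>e\<in>E. c e *\<^sub>C e) \<in> cspan (E' :: 'a::complex_inner set)"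
  by (intro complex_vector.span_sum complex_vector.span_scale complex_vector.span_base) auto

section \<open>Adjoints and conjugations\<close>

text \<open>A relational form of the adjoint: \<open>cadjoint\<close> is a definite description, which says nothing until
  an adjoint has been found, whereas pairs can be written down and combined before existence is known.\<close>
definition adjoint_pair :: "('a::complex_inner \<Rightarrow> 'a) \<Rightarrow> ('a \<Rightarrow> 'a) \<Rightarrow> bool" where
  "adjoint_pair D E \<longleftrightarrow> (\<forall>x y. cinner (D x) y = cinner x (E y))"

lemma adjoint_pairD: "adjoint_pair D E \<Longrightarrow> cinner (D x) y = cinner x (E y)"
  unfolding adjoint_pair_def by blast

lemma adjoint_pairD': "adjoint_pair D E \<Longrightarrow> cinner (E x) y = cinner x (D y)"
  by (metis adjoint_pairD cinner_commute)

lemma cadjoint_eq: "adjoint_pair D E \<Longrightarrow> cadjoint D = E"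
  by (intro cadjoint_eqI) (simp add: adjoint_pairD)

lemma adjoint_pair_unique: "adjoint_pair D E \<Longrightarrow> adjoint_pair D E' \<Longrightarrow> E = E'"
  using cadjoint_eq by metis

lemma bounded_clinearD:
  assumes "bounded_clinear D"
  shows "bounded_linear D" "D (x + y) = D x + D y" "D (x - y) = D x - D y" "D (a *\<^sub>C x) = a *\<^sub>C D x"
    "D (sum f A) = (\<Sum>i\<in>A. D (f i))" "D 0 = 0"
  using assms unfolding bounded_clinear_def
  by (auto simp: linear_simps linear_sum bounded_linear.linear linear_0)

lemma bounded_clinearI:
  assumes "\<And>x y. D (x + y) = D x + D y" "\<And>a x. D (a *\<^sub>C x) = a *\<^sub>C D x"
    "\<And>x. norm (D x) \<le> K * norm x"
  shows "bounded_clinear D"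
  unfolding bounded_clinear_def
  by (auto intro!: bounded_linear_intro[of D K] simp: assms scaleR_scaleC mult.commute[of _ K])

lemma adjoint_bounded:
  assumes "adjoint_pair D E" "\<And>x. norm (D x) \<le> K * norm x"
  shows "norm (E x) \<le> K * norm x"
proof (cases "E x = 0")
  case True
  have "0 \<le> K * norm x"
    using assms(2)[of x] norm_ge_zero order_trans by blast
  with True show ?thesis
    by simp
next
  case False
  have "(norm (E x))\<^sup>2 = cmod (cinner (D (E x)) x)"
    by (simp add: adjoint_pairD[OF assms(1)] cinner_self norm_power)
  also have "\<dots> \<le> (K * norm (E x)) * norm x"
    using complex_Cauchy_Schwarz assms(2) by (meson mult_right_mono norm_ge_zero order_trans)
  finally show ?thesis
    using False by (simp add: power2_eq_square)
qed

lemma adjoint_bounded_clinear: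
  assumes "adjoint_pair D E" "bounded_clinear D"
  shows "bounded_clinear E"
proof -
  obtain K where K: "\<And>x. norm (D x) \<le> K * norm x"
    using bounded_linear.bounded[OF bounded_clinearD(1)[OF assms(2)]] by (auto simp: mult.commute)
  show ?thesis
  proof (rule bounded_clinearI)
    show "E (x + y) = E x + E y" for x y
      by (rule cinner_ext) (simp add: cinner_simps adjoint_pairD'[OF assms(1)])
    show "E (a *\<^sub>C x) = a *\<^sub>C E x" for a x
      by (rule cinner_ext) (simp add: cinner_simps adjoint_pairD'[OF assms(1)])
    show "norm (E x) \<le> K * norm x" for x
      by (rule adjoint_bounded[OF assms(1) K])
  qed
qed

lemma conjugationD:
  assumes "conjugation C"
  shows "C (x + y) = C x + C y" "C (a *\<^sub>C x) = cnj a *\<^sub>C C x" "C (C x) = x"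
    "cinner (C x) (C y) = cinner y x" "cinner (C x) y = cinner (C y) x"
    "C (x - y) = C x - C y" "C 0 = 0" "C (sum f A) = (\<Sum>i\<in>A. C (f i))" "norm (C x) = norm x"
    "bounded_linear C"
proof -
  show add: "C (x + y) = C x + C y" for x y
    using assms unfolding conjugation_def by auto
  show scale: "C (a *\<^sub>C x) = cnj a *\<^sub>C C x" for a x
    using assms unfolding conjugation_def by auto
  show cc: "cinner (C x) (C y) = cinner y x" for x y
    using assms unfolding conjugation_def by auto
  show CC: "C (C x) = x" for x
    using assms unfolding conjugation_def by (metis bij_inv_eq_iff)
  show "cinner (C x) y = cinner (C y) x"
    using cc[of x "C y"] by (simp add: CC)
  have nm: "norm (C x) = norm x" for x
    using cc[of x x] unfolding cinner_self of_real_eq_iff by (simp add: power2_eq_iff_nonneg)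
  then show "norm (C x) = norm x" .
  show bl: "bounded_linear C"
    by (rule bounded_linear_intro[of C 1]) (auto simp: add scale scaleR_scaleC nm)
  show "C (x - y) = C x - C y" "C 0 = 0" "C (sum f A) = (\<Sum>i\<in>A. C (f i))"
    using bl by (auto simp: linear_simps linear_sum bounded_linear.linear linear_0)
qed

text \<open>With respect to a conjugation every vector is \<open>x + \<i> y\<close> with fixed vectors \<open>x\<close> and \<open>y\<close> of the
  conjugation; these fixed vectors are called real below.\<close>
definition re_part :: "('a::complex_inner \<Rightarrow> 'a) \<Rightarrow> 'a \<Rightarrow> 'a" where
  "re_part C z = (1/2) *\<^sub>C (z + C z)"

definition im_part :: "('a::complex_inner \<Rightarrow> 'a) \<Rightarrow> 'a \<Rightarrow> 'a" where
  "im_part C z = (- \<i>/2) *\<^sub>C (z - C z)"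

lemma re_im_parts:
  assumes "conjugation C"
  shows "C (re_part C z) = re_part C z" "C (im_part C z) = im_part C z"
    "z = re_part C z + \<i> *\<^sub>C im_part C z"
proof -
  show "C (re_part C z) = re_part C z"
    by (simp add: re_part_def conjugationD[OF assms] add.commute)
  show "C (im_part C z) = im_part C z"
    by (simp add: im_part_def conjugationD[OF assms] sc.diff_right sc.minus_left)
  have "re_part C z + \<i> *\<^sub>C im_part C z = (1/2) *\<^sub>C ((z + C z) + (z - C z))"
    unfolding re_part_def im_part_def scaleC_scaleC by (simp add: scaleC_add_right[symmetric])
  also have "\<dots> = (1/2) *\<^sub>C (2 *\<^sub>C z)"
    using scaleC_add_left[of 1 1 z] by (simp add: scaleC_one)
  also have "\<dots> = z"
    by (simp add: scaleC_scaleC scaleC_one)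
  finally show "z = re_part C z + \<i> *\<^sub>C im_part C z"
    by simp
qed

section \<open>Blocks of real vectors adapted to an operator\<close>

lemma orthonormal_residual:
  fixes v :: "'a::complex_inner"
  assumes "orthonormal_on E (\<lambda>e. e)" "finite E" "e \<in> E"
  shows "cinner (v - (\<Sum>e\<in>E. cinner v e *\<^sub>C e)) e = 0"
  unfolding ci.diff_left using cinner_sum_orthonormal[of E "\<lambda>e. e" E e "cinner v"] assms by simp

lemma orthonormal_on_insert:
  assumes "orthonormal_on E (\<lambda>e. e)" "norm u = 1" "\<And>e. e \<in> E \<Longrightarrow> cinner u e = 0"
  shows "orthonormal_on (insert u E) (\<lambda>e. e)"
proof -
  have "cinner u u = 1" "\<forall>e\<in>E. cinner u e = 0" "\<And>e. e \<in> E \<Longrightarrow> cinner e u = 0"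
    using assms(2,3) by (simp_all add: norm_eq_one_iff_cinner cinner_eq_0_commute)
  then show ?thesis
    using assms(1) unfolding orthonormal_on_def by auto
qed

lemma finite_orthonormal_span:
  fixes G :: "'a::complex_inner set"
  assumes "finite G"
  shows "\<exists>E. finite E \<and> orthonormal_on E (\<lambda>e. e) \<and> G \<subseteq> cspan E"
  using assms
proof (induction G rule: finite_induct)
  case empty
  show ?case
    by (rule exI[of _ "{}"]) (simp add: orthonormal_on_def)
next
  case (insert v G)
  then obtain E where E: "finite E" "orthonormal_on E (\<lambda>e. e)" "G \<subseteq> cspan E"
    by blast
  define s where "s = (\<Sum>e\<in>E. cinner v e *\<^sub>C e)"
  define y where "y = v - s"
  have s: "s \<in> cspan E'" if "E \<subseteq> E'" for E'
    unfolding s_def using that by (rule sum_scaleC_in_cspan)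
  show ?case
  proof (cases "y = 0")
    case True
    then show ?thesis
      using E s[of E] by (auto simp: y_def)
  next
    case False
    define u where "u = complex_of_real (1 / norm y) *\<^sub>C y"
    have u: "norm u = 1" "\<And>e. e \<in> E \<Longrightarrow> cinner u e = 0"
      using False orthonormal_residual[OF E(2,1), of _ v] by (simp_all add: u_def norm_scaleC cinner_simps y_def s_def norm_divide)
    have "v = s + complex_of_real (norm y) *\<^sub>C u"
      using False by (simp add: u_def scaleC_scaleC scaleC_one) (simp add: y_def)
    then have "v \<in> cspan (insert u E)"
      by (metis s subset_insertI insertI1 complex_vector.span_add complex_vector.span_scale
          complex_vector.span_base)
    then show ?thesis
      using E u complex_vector.span_mono[of E "insert u E"]
      by (intro exI[of _ "insert u E"]) (auto intro!: orthonormal_on_insert)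
  qed
qed

text \<open>In infinite dimension some nonzero vector is orthogonal to \<open>G \<union> C ` G\<close>. This union is invariant
  under \<open>C\<close>, so the real and the imaginary part of the vector are orthogonal to it too, and they are not
  both zero.\<close>
lemma real_unit_vector_orthogonal:
  fixes C :: "'a::complex_inner \<Rightarrow> 'a"
  assumes inf: "\<not> (\<exists>B :: 'a set. finite B \<and> cspan B = UNIV)"
    and C: "conjugation C" and "finite G"
  shows "\<exists>u. C u = u \<and> norm u = 1 \<and> (\<forall>g\<in>G. cinner u g = 0)"
proof -
  note cD = conjugationD[OF C]
  obtain E where E: "finite E" "orthonormal_on E (\<lambda>e. e)" "G \<union> C ` G \<subseteq> cspan E"
    using finite_orthonormal_span[of "G \<union> C ` G"] \<open>finite G\<close> by auto
  obtain x where x: "x \<notin> cspan E"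
    using inf E(1) by blast
  define y where "y = x - (\<Sum>e\<in>E. cinner x e *\<^sub>C e)"
  have "(\<Sum>e\<in>E. cinner x e *\<^sub>C e) \<in> cspan E"
    by (rule sum_scaleC_in_cspan) simp
  with x have "y \<noteq> 0"
    by (auto simp: y_def)
  have "cinner e y = 0" if "e \<in> E" for e
    unfolding y_def by (rule cinner_eq_0_commute) (rule orthonormal_residual[OF E(2,1) that])
  then have "cinner g y = 0" if "g \<in> G \<union> C ` G" for g
    using cspan_orthogonal[of g E y] that E(3) by blast
  then have yG: "cinner y g = 0" "cinner (C y) g = 0" if "g \<in> G" for g
    using that cD(5)[of y g] by (auto intro: cinner_eq_0_commute)
  have "\<exists>w. C w = w \<and> w \<noteq> 0 \<and> (\<forall>g\<in>G. cinner w g = 0)"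
  proof (cases "re_part C y = 0")
    case True
    with re_im_parts(3)[OF C, of y] \<open>y \<noteq> 0\<close> have "im_part C y \<noteq> 0"
      by (auto simp: sc.zero_right)
    then show ?thesis
      using yG re_im_parts[OF C, of y] by (intro exI[of _ "im_part C y"]) (auto simp: im_part_def cinner_simps)
  next
    case False
    then show ?thesis
      using yG re_im_parts[OF C, of y] by (intro exI[of _ "re_part C y"]) (auto simp: re_part_def cinner_simps)
  qed
  then obtain w where w: "C w = w" "w \<noteq> 0" "\<And>g. g \<in> G \<Longrightarrow> cinner w g = 0"
    by blast
  then show ?thesis
    by (intro exI[of _ "complex_of_real (1 / norm w) *\<^sub>C w"])
      (auto simp: cD norm_scaleC cinner_simps norm_divide)
qed

text \<open>One Gram-Schmidt step. If \<open>v\<close> lies already in the span of \<open>E\<close>, the new vector is arbitrary; it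
  only keeps the enumeration going. All inner products of real vectors are real numbers, so the residual
  of \<open>v\<close> is again real, and it inherits the orthogonality to \<open>F\<close>.\<close>
lemma extend_real_orthonormal:
  fixes C :: "'a::complex_inner \<Rightarrow> 'a"
  assumes inf: "\<not> (\<exists>B :: 'a set. finite B \<and> cspan B = UNIV)"
    and C: "conjugation C" and fin: "finite E" "finite F" and E: "orthonormal_on E (\<lambda>e. e)"
    and real: "\<And>e. e \<in> E \<Longrightarrow> C e = e" "C v = v"
    and perp: "\<And>e f. e \<in> E \<Longrightarrow> f \<in> F \<Longrightarrow> cinner e f = 0" "\<And>f. f \<in> F \<Longrightarrow> cinner v f = 0"
  shows "\<exists>u. C u = u \<and> norm u = 1 \<and> (\<forall>e\<in>E. cinner u e = 0) \<and> (\<forall>f\<in>F. cinner u f = 0)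
           \<and> v \<in> cspan (insert u E)"
proof -
  note cD = conjugationD[OF C]
  define s where "s = (\<Sum>e\<in>E. cinner v e *\<^sub>C e)"
  define y where "y = v - s"
  have s: "s \<in> cspan (insert u E)" for u
    unfolding s_def by (rule sum_scaleC_in_cspan) auto
  have "cnj (cinner v e) = cinner v e" if "e \<in> E" for e
    using cD(4)[of v e] real that cinner_commute[of e v] by simp
  then have Cy: "C y = y"
    unfolding y_def s_def by (simp add: cD real cong: sum.cong)
  have yE: "cinner y e = 0" if "e \<in> E" for e
    using orthonormal_residual[OF E fin(1) that] by (simp add: y_def s_def)
  have yF: "cinner y f = 0" if "f \<in> F" for f
    using perp that by (simp add: y_def s_def cinner_simps)
  show ?thesis
  proof (cases "y = 0")
    case True
    obtain u where "C u = u" "norm u = 1" "\<forall>g\<in>E \<union> F. cinner u g = 0"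
      using real_unit_vector_orthogonal[OF inf C, of "E \<union> F"] fin by auto
    then show ?thesis
      using True s[of u] by (intro exI[of _ u]) (auto simp: y_def)
  next
    case False
    define u where "u = complex_of_real (1 / norm y) *\<^sub>C y"
    have "v = s + complex_of_real (norm y) *\<^sub>C u"
      using False by (simp add: u_def scaleC_scaleC scaleC_one) (simp add: y_def)
    then have "v \<in> cspan (insert u E)"
      by (metis s insertI1 complex_vector.span_add complex_vector.span_scale
          complex_vector.span_base)
    then show ?thesis
      using False Cy yE yF
      by (intro exI[of _ u]) (auto simp: u_def cD norm_scaleC cinner_simps norm_divide)
  qed
qed

text \<open>The vector that has to enter the span when \<open>u (n + 1)\<close> is chosen: each \<open>u i\<close> contributes the
  real part of \<open>T (u i)\<close> at \<open>n = 2 * i\<close> and its imaginary part at \<open>n = 2 * i + 1\<close>.\<close>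
definition krylov_target :: "('a::complex_inner \<Rightarrow> 'a) \<Rightarrow> ('a \<Rightarrow> 'a) \<Rightarrow> (nat \<Rightarrow> 'a) \<Rightarrow> nat \<Rightarrow> 'a" where
  "krylov_target C T u n =
     (if even n then re_part C (T (u (n div 2))) else im_part C (T (u (n div 2))))"

definition krylov_block ::
  "('a::complex_inner \<Rightarrow> 'a) \<Rightarrow> ('a \<Rightarrow> 'a) \<Rightarrow> 'a set \<Rightarrow> nat \<Rightarrow> (nat \<Rightarrow> 'a) \<Rightarrow> bool" where
  "krylov_block C T F N u \<longleftrightarrow>
     orthonormal_on {..N} u \<and> (\<forall>i\<le>N. C (u i) = u i) \<and> (\<forall>i\<le>N. \<forall>f\<in>F. cinner (u i) f = 0) \<and>
     (\<forall>n<N. krylov_target C T u n \<in> cspan (u ` {..Suc n}))"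

text \<open>The new vector is a combination of the earlier vectors and of images of these under \<open>T\<close> and
  \<open>T\<^sup>*\<close>. For it to be orthogonal to \<open>F\<close> the earlier ones must be orthogonal to \<open>T\<^sup>* F\<close> and \<open>T F\<close> as
  well, and therefore \<open>F\<close> is generalised in the induction. Every further
  vector enlarges the set to be avoided, so only finite blocks arise.\<close>
lemma krylov_block_exists:
  fixes C :: "'a::complex_inner \<Rightarrow> 'a"
  assumes inf: "\<not> (\<exists>B :: 'a set. finite B \<and> cspan B = UNIV)"
    and C: "conjugation C" and T: "adjoint_pair T (C \<circ> T \<circ> C)" and "finite F"
  shows "\<exists>u. krylov_block C T F N u"
  using \<open>finite F\<close>
proof (induction N arbitrary: F)
  case 0
  then obtain u where "C u = u" "norm u = 1" "\<forall>f\<in>F. cinner u f = 0"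
    using real_unit_vector_orthogonal[OF inf C] by blast
  then show ?case
    by (intro exI[of _ "\<lambda>_. u"])
      (auto simp: krylov_block_def orthonormal_on_def norm_eq_one_iff_cinner[symmetric])
next
  case (Suc N)
  note cD = conjugationD[OF C]
  define S where "S = C \<circ> T \<circ> C"
  have TS: "adjoint_pair T S"
    using T by (simp add: S_def)
  have "finite (F \<union> T ` F \<union> S ` F)"
    using Suc.prems by simp
  from Suc.IH[OF this] obtain u where u: "krylov_block C T (F \<union> T ` F \<union> S ` F) N u"
    by blast
  then have on: "orthonormal_on {..N} u" and Cu: "\<And>i. i \<le> N \<Longrightarrow> C (u i) = u i"
    and uF: "\<And>i f. i \<le> N \<Longrightarrow> f \<in> F \<union> T ` F \<union> S ` F \<Longrightarrow> cinner (u i) f = 0"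
    and tgt: "\<And>n. n < N \<Longrightarrow> krylov_target C T u n \<in> cspan (u ` {..Suc n})"
    unfolding krylov_block_def by blast+
  have inj: "inj_on u {..N}"
    unfolding inj_on_def using on by (metis orthonormal_onD zero_neq_one)
  define v where "v = krylov_target C T u N"
  have le: "N div 2 \<le> N"
    by simp
  have "C (T (u (N div 2))) = S (u (N div 2))"
    by (simp add: S_def Cu)
  then have "cinner (T (u (N div 2))) f = 0" "cinner (C (T (u (N div 2)))) f = 0" if "f \<in> F" for f
    using that uF[OF le] by (auto simp: adjoint_pairD[OF TS] adjoint_pairD'[OF TS])
  then have vF: "cinner v f = 0" if "f \<in> F" for f
    using that by (auto simp: v_def krylov_target_def re_part_def im_part_def cinner_simps)
  have Cv: "C v = v"
    by (simp add: v_def krylov_target_def re_im_parts[OF C])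
  have "orthonormal_on (u ` {..N}) (\<lambda>e. e)"
    using on inj unfolding orthonormal_on_def inj_on_def by auto
  then obtain w where w: "C w = w" "norm w = 1" "\<forall>e\<in>u ` {..N}. cinner w e = 0"
    "\<forall>f\<in>F. cinner w f = 0" "v \<in> cspan (insert w (u ` {..N}))"
    using extend_real_orthonormal[OF inf C _ \<open>finite F\<close>, of "u ` {..N}" v] Cu Cv uF vF by force
  define u' where "u' = u(Suc N := w)"
  have u': "u' i = u i" if "i \<le> N" for i
    using that by (simp add: u'_def)
  have u'N: "u' (Suc N) = w"
    by (simp add: u'_def)
  have img: "u' ` {..Suc N} = insert w (u ` {..N})"
    by (auto simp: u'_def atMost_Suc)
  have ww: "cinner w w = 1" and uw: "\<And>i. i \<le> N \<Longrightarrow> cinner (u i) w = 0"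
    using w(2,3) by (auto simp: norm_eq_one_iff_cinner cinner_eq_0_commute)
  have "orthonormal_on {..Suc N} u'"
    unfolding orthonormal_on_def
  proof (intro ballI)
    fix p q assume "p \<in> {..Suc N}" "q \<in> {..Suc N}"
    then show "cinner (u' p) (u' q) = (if p = q then 1 else 0)"
      using w(3) on ww by (cases "p = Suc N"; cases "q = Suc N")
        (auto simp: u'_def orthonormal_onD uw)
  qed
  moreover have "krylov_target C T u' n \<in> cspan (u' ` {..Suc n})" if "n < Suc N" for n
  proof (cases "n = N")
    case True
    have "krylov_target C T u' N = v"
      by (simp add: v_def krylov_target_def u')
    then show ?thesis
      using w(5) True img by simp
  next
    case False
    then have "krylov_target C T u' n = krylov_target C T u n"
      using that by (simp add: krylov_target_def u')
    moreover have "u' ` {..Suc n} = u ` {..Suc n}"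
      by (rule image_cong) (use that False u' in auto)
    ultimately show ?thesis
      using tgt[of n] that False by simp
  qed
  ultimately show ?case
    using w Cu uF u' u'N by (intro exI[of _ u']) (auto simp: krylov_block_def le_Suc_eq)
qed

text \<open>The two targets contributed by \<open>u i\<close> put \<open>T (u i)\<close> into the span of \<open>u 0, \<dots>, u (2 * i + 2)\<close>.\<close>
lemma krylov_block_image:
  fixes C :: "'a::complex_inner \<Rightarrow> 'a"
  assumes C: "conjugation C" and u: "krylov_block C T F N u" and "2 * i + 2 \<le> N"
  shows "T (u i) = (\<Sum>j\<le>2 * i + 2. cinner (T (u i)) (u j) *\<^sub>C u j)"
proof -
  have on: "orthonormal_on {..2 * i + 2} u"
    using u assms(3) unfolding krylov_block_def by (auto intro: orthonormal_on_subset)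
  have tgt: "krylov_target C T u n \<in> cspan (u ` {..2 * i + 2})" if "n \<le> 2 * i + 1" for n
  proof -
    have "krylov_target C T u n \<in> cspan (u ` {..Suc n})"
      using u that assms(3) unfolding krylov_block_def by simp
    also have "\<dots> \<subseteq> cspan (u ` {..2 * i + 2})"
      by (intro complex_vector.span_mono image_mono) (use that in auto)
    finally show ?thesis .
  qed
  have "T (u i) = krylov_target C T u (2 * i) + \<i> *\<^sub>C krylov_target C T u (2 * i + 1)"
    using re_im_parts(3)[OF C] by (simp add: krylov_target_def)
  then have "T (u i) \<in> cspan (u ` {..2 * i + 2})"
    by (metis (no_types) tgt complex_vector.span_add complex_vector.span_scale le_add1 order_refl)
  from cspan_orthonormal_expansion[OF on _ this] show ?thesis
    by simp
qed

section \<open>Orthonormal bases and operators given by their columns\<close>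

instance chilbert_space \<subseteq> banach ..

text \<open>Bases are indexed by \<open>nat\<close>, so that expansions are ordinary series; operators on a countable
  direct sum are handled by reading the index as a pair through \<open>prod_decode\<close>.\<close>
definition hilbert_basis :: "(nat \<Rightarrow> 'a::complex_inner) \<Rightarrow> bool" where
  "hilbert_basis h \<longleftrightarrow> orthonormal_on UNIV h \<and> closure (cspan (range h)) = UNIV"

text \<open>Gram-Schmidt applied to the real and imaginary parts of a dense sequence.\<close>
lemma real_hilbert_basis_exists:
  fixes C :: "'a::complex_inner \<Rightarrow> 'a"
  assumes inf: "\<not> (\<exists>B :: 'a set. finite B \<and> cspan B = UNIV)"
    and sep: "separable_space (euclidean :: 'a topology)"
    and C: "conjugation C"
  shows "\<exists>h. hilbert_basis h \<and> (\<forall>n. C (h n) = h n)"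
proof -
  obtain U :: "'a set" where U: "countable U" "closure U = UNIV"
    using sep unfolding separable_space_def by auto
  have "U \<noteq> {}"
    using U(2) by auto
  define d where "d = from_nat_into U"
  have d: "range d = U"
    using U \<open>U \<noteq> {}\<close> unfolding d_def by (intro range_from_nat_into) auto
  define r where "r n = (if even n then re_part C (d (n div 2)) else im_part C (d (n div 2)))" for n
  have Cr: "C (r n) = r n" for n
    by (simp add: r_def re_im_parts[OF C])
  define good where "good E \<longleftrightarrow> finite E \<and> orthonormal_on E (\<lambda>e. e) \<and> (\<forall>e\<in>E. C e = e)" for E
  define new where "new E v u \<longleftrightarrow> C u = u \<and> norm u = 1 \<and> (\<forall>e\<in>E. cinner u e = 0)
    \<and> v \<in> cspan (insert u E)" for E v u
  have "\<exists>u. new E v u" if "good E" "C v = v" for E v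
    using extend_real_orthonormal[OF inf C, of E "{}" v] that unfolding good_def new_def by auto
  then obtain nxt where nxt: "\<And>E v. good E \<Longrightarrow> C v = v \<Longrightarrow> new E v (nxt E v)"
    by metis
  define E where "E = rec_nat {} (\<lambda>n E. insert (nxt E (r n)) E)"
  define h where "h n = nxt (E n) (r n)" for n
  have E_Suc: "E (Suc n) = insert (h n) (E n)" for n
    by (simp add: E_def h_def)
  have good: "good (E n)" for n
  proof (induction n)
    case 0
    show ?case
      by (simp add: E_def good_def orthonormal_on_def)
  next
    case (Suc n)
    then have "new (E n) (r n) (h n)"
      unfolding h_def using nxt Cr by blast
    with Suc show ?case
      unfolding E_Suc good_def new_def by (auto intro!: orthonormal_on_insert)
  qed
  have new: "new (E n) (r n) (h n)" for n
    unfolding h_def using nxt Cr good by blast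
  have hE: "m < n \<Longrightarrow> h m \<in> E n" for m n
    by (induction n) (auto simp: E_Suc less_Suc_eq)
  have Eh: "E n \<subseteq> range h" for n
    by (induction n) (auto simp: E_Suc, simp add: E_def)
  have orth: "cinner (h n) (h m) = 0" if "m < n" for m n
    using new[of n] hE[OF that] unfolding new_def by blast
  have "orthonormal_on UNIV h"
    unfolding orthonormal_on_def
  proof (intro ballI)
    fix p q
    show "cinner (h p) (h q) = (if p = q then 1 else 0)"
      using new[of p] orth[of q p] cinner_eq_0_commute[OF orth[of p q]] unfolding new_def norm_eq_one_iff_cinner
      by (cases p q rule: linorder_cases) auto
  qed
  moreover have "U \<subseteq> cspan (range h)"
  proof
    fix x assume "x \<in> U"
    then obtain n where n: "x = d n"
      using d by auto
    have "r k \<in> cspan (range h)" for k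
      using new[of k] complex_vector.span_mono[of "insert (h k) (E k)" "range h"] Eh[of k]
      unfolding new_def by auto
    moreover have "x = r (2 * n) + \<i> *\<^sub>C r (2 * n + 1)"
      using re_im_parts(3)[OF C, of x] by (simp add: r_def n)
    ultimately show "x \<in> cspan (range h)"
      by (metis complex_vector.span_add complex_vector.span_scale)
  qed
  then have "closure (cspan (range h)) = UNIV"
    using U(2) closure_mono by blast
  moreover have "C (h n) = h n" for n
    using new[of n] by (simp add: new_def)
  ultimately show ?thesis
    unfolding hilbert_basis_def by blast
qed

lemma hilbert_basis_total:
  assumes "hilbert_basis h" "\<And>n. cinner (h n) x = 0"
  shows "x = 0"
proof -
  have "cspan (range h) \<subseteq> {z. cinner z x = 0}"
    using cspan_orthogonal[of _ "range h" x] assms(2) by blast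
  moreover have "closed {z. cinner z x = 0}"
    by (intro closed_Collect_eq continuous_intros ci.continuous_on)
  ultimately have "closure (cspan (range h)) \<subseteq> {z. cinner z x = 0}"
    by (rule closure_minimal)
  then have "cinner x x = 0"
    using assms(1) unfolding hilbert_basis_def by blast
  then show ?thesis
    by simp
qed

text \<open>The operator that maps the vectors of an orthonormal basis to the columns \<open>w\<close> has norm at most \<open>K\<close>. Only
  finite combinations occur, so the condition makes sense before the operator has been constructed, and
  it can be checked by orthogonality arguments on finite sums.\<close>
definition bounded_columns :: "real \<Rightarrow> ('i \<Rightarrow> 'a::complex_inner) \<Rightarrow> bool" where
  "bounded_columns K w \<longleftrightarrow> 0 \<le> K \<and> (\<forall>F c. finite F \<longrightarrow>
     (norm (\<Sum>p\<in>F. c p *\<^sub>C w p))\<^sup>2 \<le> K\<^sup>2 * (\<Sum>p\<in>F. (cmod (c p))\<^sup>2))"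

lemma bounded_columnsD:
  "bounded_columns K w \<Longrightarrow> finite F \<Longrightarrow>
     (norm (\<Sum>p\<in>F. c p *\<^sub>C w p))\<^sup>2 \<le> K\<^sup>2 * (\<Sum>p\<in>F. (cmod (c p))\<^sup>2)"
  unfolding bounded_columns_def by blast

lemma orthonormal_bounded_columns: "orthonormal_on UNIV w \<Longrightarrow> bounded_columns 1 w"
  unfolding bounded_columns_def by (auto simp: orthonormal_on_norm_sum)

lemma bounded_columns_summable:
  fixes w :: "nat \<Rightarrow> 'a::chilbert_space"
  assumes w: "bounded_columns K w" and c: "\<And>N. (\<Sum>n<N. (cmod (c n))\<^sup>2) \<le> M"
  shows "summable (\<lambda>n. c n *\<^sub>C w n)"
  unfolding summable_Cauchy
proof (intro allI impI)
  fix e :: real assume "e > 0"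
  have "0 \<le> K"
    using w by (simp add: bounded_columns_def)
  have "summable (\<lambda>n. (cmod (c n))\<^sup>2)"
    using c by (intro summableI_nonneg_bounded) auto
  then obtain N where N: "\<And>m n. m \<ge> N \<Longrightarrow> norm (\<Sum>n\<in>{m..<n}. (cmod (c n))\<^sup>2) < (e / (K + 1))\<^sup>2"
    using \<open>e > 0\<close> \<open>0 \<le> K\<close> unfolding summable_Cauchy
    by (metis (no_types) add_nonneg_pos divide_pos_pos zero_less_one zero_less_power)
  have "norm (\<Sum>n\<in>{m..<n}. c n *\<^sub>C w n) < e" if "m \<ge> N" for m n
  proof -
    have "(norm (\<Sum>n\<in>{m..<n}. c n *\<^sub>C w n))\<^sup>2 \<le> K\<^sup>2 * (\<Sum>n\<in>{m..<n}. (cmod (c n))\<^sup>2)"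
      by (rule bounded_columnsD[OF w]) simp
    also have "\<dots> \<le> (K + 1)\<^sup>2 * (\<Sum>n\<in>{m..<n}. (cmod (c n))\<^sup>2)"
      using \<open>0 \<le> K\<close> by (intro mult_right_mono power_mono sum_nonneg) auto
    also have "\<dots> < (K + 1)\<^sup>2 * (e / (K + 1))\<^sup>2"
      using N[OF that, of n] \<open>0 \<le> K\<close> by (intro mult_strict_left_mono) (auto simp: sum_nonneg)
    also have "\<dots> = e\<^sup>2"
      using \<open>0 \<le> K\<close> by (simp add: power_divide)
    finally show ?thesis
      using \<open>e > 0\<close> by (simp add: power2_less_imp_less)
  qed
  then show "\<exists>N. \<forall>m\<ge>N. \<forall>n. norm (sum (\<lambda>n. c n *\<^sub>C w n) {m..<n}) < e"
    by blast
qed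

lemma hilbert_basis_sums:
  fixes h :: "nat \<Rightarrow> 'a::chilbert_space"
  assumes h: "hilbert_basis h"
  shows "(\<lambda>n. cinner x (h n) *\<^sub>C h n) sums x"
proof -
  have on: "orthonormal_on UNIV h"
    using h by (simp add: hilbert_basis_def)
  have "summable (\<lambda>n. cinner x (h n) *\<^sub>C h n)"
    by (rule bounded_columns_summable[OF orthonormal_bounded_columns[OF on]])
      (rule Bessel[OF on], auto)
  then obtain s where s: "(\<lambda>n. cinner x (h n) *\<^sub>C h n) sums s"
    by (auto simp: summable_def)
  have "cinner s (h m) = cinner x (h m)" for m
  proof -
    have "(\<lambda>n. cinner (cinner x (h n) *\<^sub>C h n) (h m)) sums cinner s (h m)"
      by (rule bounded_linear.sums[OF ci.bounded_linear_left s])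
    moreover have "(\<lambda>n. cinner (cinner x (h n) *\<^sub>C h n) (h m)) = (\<lambda>n. if n = m then cinner x (h m) else 0)"
      by (auto simp: cinner_simps orthonormal_onD[OF on])
    ultimately have "(\<lambda>n. if n = m then cinner x (h m) else 0) sums cinner s (h m)"
      by simp
    from sums_unique2[OF this sums_single] show ?thesis .
  qed
  then have "cinner (h m) (s - x) = 0" for m
    using cinner_eq_0_commute[of "s - x" "h m"] by (simp add: cinner_simps)
  from hilbert_basis_total[OF h this] s show ?thesis
    by simp
qed

lemma bounded_columns_norm:
  fixes h :: "nat \<Rightarrow> 'a::chilbert_space"
  assumes h: "hilbert_basis h" and w: "bounded_columns K w"
    and y: "(\<lambda>n. cinner x (h n) *\<^sub>C w n) sums y"
  shows "norm y \<le> K * norm x"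
proof (rule LIMSEQ_le_const2)
  show "(\<lambda>N. norm (\<Sum>n<N. cinner x (h n) *\<^sub>C w n)) \<longlonglongrightarrow> norm y"
    using y unfolding sums_def by (rule tendsto_norm)
  have "norm (\<Sum>n<N. cinner x (h n) *\<^sub>C w n) \<le> K * norm x" for N
  proof (rule power2_le_imp_le)
    have "(norm (\<Sum>n<N. cinner x (h n) *\<^sub>C w n))\<^sup>2 \<le> K\<^sup>2 * (\<Sum>n<N. (cmod (cinner x (h n)))\<^sup>2)"
      by (rule bounded_columnsD[OF w]) simp
    also have "\<dots> \<le> K\<^sup>2 * (norm x)\<^sup>2"
      using h by (intro mult_left_mono Bessel[of UNIV]) (auto simp: hilbert_basis_def)
    finally show "(norm (\<Sum>n<N. cinner x (h n) *\<^sub>C w n))\<^sup>2 \<le> (K * norm x)\<^sup>2"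
      by (simp add: power_mult_distrib)
    show "0 \<le> K * norm x"
      using w by (simp add: bounded_columns_def)
  qed
  then show "\<exists>N. \<forall>n\<ge>N. norm (\<Sum>n<n. cinner x (h n) *\<^sub>C w n) \<le> K * norm x"
    by blast
qed

lemma bounded_clinear_sums:
  fixes h :: "nat \<Rightarrow> 'a::chilbert_space"
  assumes "hilbert_basis h" "bounded_clinear D"
  shows "(\<lambda>n. cinner x (h n) *\<^sub>C D (h n)) sums D x"
  using bounded_linear.sums[OF bounded_clinearD(1)[OF assms(2)] hilbert_basis_sums[OF assms(1), of x]]
  by (simp add: bounded_clinearD(4)[OF assms(2)])

lemma bounded_clinear_eqI:
  fixes h :: "nat \<Rightarrow> 'a::chilbert_space"
  assumes "hilbert_basis h" "bounded_clinear D" "bounded_clinear D'" "\<And>n. D (h n) = D' (h n)"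
  shows "D = D'"
proof
  fix x
  show "D x = D' x"
    using sums_unique2[OF bounded_clinear_sums[OF assms(1,2), of x]]
      bounded_clinear_sums[OF assms(1,3), of x] assms(4) by simp
qed

lemma norm_le_of_bounded_columns:
  fixes h :: "nat \<Rightarrow> 'a::chilbert_space"
  assumes "hilbert_basis h" "bounded_clinear D" "bounded_columns K (\<lambda>n. D (h n))"
  shows "norm (D x) \<le> K * norm x"
  by (rule bounded_columns_norm[OF assms(1,3) bounded_clinear_sums[OF assms(1,2)]])

text \<open>The adjoint of a matrix has the same norm: with \<open>z = (\<Sum>p\<in>F. cinner y (w p) *\<^sub>C w p)\<close> the sum \<open>S\<close>
  on the left equals \<open>cinner y z\<close>, while the norm of \<open>z\<close> is at most \<open>K * sqrt S\<close>.\<close>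
lemma bounded_columns_dual:
  fixes w :: "'i \<Rightarrow> 'a::complex_inner"
  assumes w: "bounded_columns K w" and "finite F"
  shows "(\<Sum>p\<in>F. (cmod (cinner y (w p)))\<^sup>2) \<le> K\<^sup>2 * (norm y)\<^sup>2"
proof -
  define S where "S = (\<Sum>p\<in>F. (cmod (cinner y (w p)))\<^sup>2)"
  define z where "z = (\<Sum>p\<in>F. cinner y (w p) *\<^sub>C w p)"
  have "S \<ge> 0"
    by (auto simp: S_def sum_nonneg)
  have "complex_of_real S = cinner y z"
    by (simp add: S_def z_def cinner_simps complex_norm_square mult.commute del: of_real_power)
  then have "S = cmod (cinner y z)"
    using \<open>S \<ge> 0\<close> by (metis abs_of_nonneg norm_of_real)
  also have "\<dots> \<le> norm y * norm z"
    by (rule complex_Cauchy_Schwarz)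
  finally have "S\<^sup>2 \<le> (norm y)\<^sup>2 * (norm z)\<^sup>2"
    using \<open>S \<ge> 0\<close> by (metis power_mono power_mult_distrib)
  also have "\<dots> \<le> (norm y)\<^sup>2 * (K\<^sup>2 * S)"
    unfolding z_def S_def by (intro mult_left_mono bounded_columnsD[OF w] \<open>finite F\<close>) auto
  finally have "S * S \<le> (K\<^sup>2 * (norm y)\<^sup>2) * S"
    by (simp add: power2_eq_square mult_ac)
  then show ?thesis
    using \<open>S \<ge> 0\<close> unfolding S_def[symmetric]
    by (cases "S = 0") (auto simp: mult_le_cancel_right)
qed

text \<open>Both the operator and its adjoint are given by explicit series, the second of which
  converges by \<open>bounded_columns_dual\<close>. Applied to the columns of a given operator, this shows that the
  operator has an adjoint.\<close>
lemma operator_of_columns: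
  fixes h :: "nat \<Rightarrow> 'a::chilbert_space"
  assumes h: "hilbert_basis h" and w: "bounded_columns K w"
  shows "\<exists>D E. bounded_clinear D \<and> adjoint_pair D E \<and> (\<forall>n. D (h n) = w n) \<and>
           (\<forall>x. norm (D x) \<le> K * norm x)"
proof -
  have on: "orthonormal_on UNIV h"
    using h by (simp add: hilbert_basis_def)
  define D where "D x = (\<Sum>n. cinner x (h n) *\<^sub>C w n)" for x
  define E where "E y = (\<Sum>n. cinner y (w n) *\<^sub>C h n)" for y
  have D: "(\<lambda>n. cinner x (h n) *\<^sub>C w n) sums D x" for x
    unfolding D_def by (intro summable_sums bounded_columns_summable[OF w, of _ "(norm x)\<^sup>2"] Bessel[OF on]) auto
  have E: "(\<lambda>n. cinner y (w n) *\<^sub>C h n) sums E y" for y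
    unfolding E_def
    by (intro summable_sums bounded_columns_dual[OF w]
        bounded_columns_summable[OF orthonormal_bounded_columns[OF on], of _ "K\<^sup>2 * (norm y)\<^sup>2"]) simp
  have "bounded_clinear D"
  proof (rule bounded_clinearI)
    show "D (x + y) = D x + D y" for x y
      using sums_unique2[OF D[of "x + y"]] sums_add[OF D[of x] D[of y]]
      by (simp add: cinner_simps scaleC_add_left)
    show "D (a *\<^sub>C x) = a *\<^sub>C D x" for a x
      using sums_unique2[OF D[of "a *\<^sub>C x"]] bounded_linear.sums[OF sc.bounded_linear_right D[of x], of a]
      by (simp add: cinner_simps scaleC_scaleC)
    show "norm (D x) \<le> K * norm x" for x
      by (rule bounded_columns_norm[OF h w D])
  qed
  moreover have "adjoint_pair D E"
    unfolding adjoint_pair_def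
  proof (intro allI)
    fix x y
    have "(\<lambda>n. cinner x (h n) * cinner (w n) y) sums cinner (D x) y"
      using bounded_linear.sums[OF ci.bounded_linear_left D[of x], of y] by (simp add: cinner_simps)
    moreover have "(\<lambda>n. cinner x (h n) * cinner (w n) y) sums cinner x (E y)"
      using bounded_linear.sums[OF ci.bounded_linear_right E[of y], of x]
      by (simp add: cinner_simps cinner_commute[of "w _" y] mult.commute)
    ultimately show "cinner (D x) y = cinner x (E y)"
      by (rule sums_unique2)
  qed
  moreover have "D (h m) = w m" for m
  proof -
    have "(\<lambda>n. cinner (h m) (h n) *\<^sub>C w n) = (\<lambda>n. if n = m then w n else 0)"
      by (auto simp: orthonormal_onD[OF on] scaleC_one sc.zero_left)
    with D[of "h m"] have "(\<lambda>n. if n = m then w n else 0) sums D (h m)"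
      by simp
    from sums_unique2[OF this sums_single] show ?thesis .
  qed
  moreover have "norm (D x) \<le> K * norm x" for x
    by (rule bounded_columns_norm[OF h w D])
  ultimately show ?thesis
    by blast
qed

lemma bounded_columns_operator:
  fixes D :: "'a::complex_inner \<Rightarrow> 'a" and v :: "'i \<Rightarrow> 'a"
  assumes "bounded_clinear D" "\<And>x. norm (D x) \<le> K * norm x" "0 \<le> K" "orthonormal_on UNIV v"
  shows "bounded_columns K (\<lambda>n. D (v n))"
  unfolding bounded_columns_def
proof (intro conjI allI impI)
  fix F :: "'i set" and c :: "'i \<Rightarrow> complex"
  assume "finite F"
  have "(\<Sum>p\<in>F. c p *\<^sub>C D (v p)) = D (\<Sum>p\<in>F. c p *\<^sub>C v p)"
    by (simp add: bounded_clinearD[OF assms(1)])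
  then have "(norm (\<Sum>p\<in>F. c p *\<^sub>C D (v p)))\<^sup>2 \<le> (K * norm (\<Sum>p\<in>F. c p *\<^sub>C v p))\<^sup>2"
    using assms(2) by (simp add: power_mono)
  also have "\<dots> = K\<^sup>2 * (\<Sum>p\<in>F. (cmod (c p))\<^sup>2)"
    using orthonormal_on_norm_sum[OF assms(4) \<open>finite F\<close>, of c] by (simp add: power_mult_distrib)
  finally show "(norm (\<Sum>p\<in>F. c p *\<^sub>C D (v p)))\<^sup>2 \<le> K\<^sup>2 * (\<Sum>p\<in>F. (cmod (c p))\<^sup>2)" .
qed (rule assms(3))

lemma bounded_clinear_norm_bound:
  assumes "bounded_clinear D"
  obtains K where "0 \<le> K" "\<And>x. norm (D x) \<le> K * norm x"
  using bounded_linear.nonneg_bounded[OF bounded_clinearD(1)[OF assms]] by (auto simp: mult.commute)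

lemma adjoint_exists:
  fixes h :: "nat \<Rightarrow> 'a::chilbert_space" and D :: "'a \<Rightarrow> 'a"
  assumes h: "hilbert_basis h" and D: "bounded_clinear D"
  shows "\<exists>E. adjoint_pair D E"
proof -
  obtain K where K: "0 \<le> K" "\<And>x. norm (D x) \<le> K * norm x"
    using bounded_clinear_norm_bound[OF D] by blast
  have "bounded_columns K (\<lambda>n. D (h n))"
    by (rule bounded_columns_operator[OF D K(2,1)]) (use h in \<open>simp add: hilbert_basis_def\<close>)
  from operator_of_columns[OF h this] bounded_clinear_eqI[OF h _ D] show ?thesis
    by metis
qed

lemma adjoint_pair_by_entries:
  fixes h :: "nat \<Rightarrow> 'a::chilbert_space"
  assumes h: "hilbert_basis h" and D: "bounded_clinear D" and E: "bounded_clinear E"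
    and entries: "\<And>p q. cinner (D (h p)) (h q) = cinner (h p) (E (h q))"
  shows "adjoint_pair D E"
proof -
  obtain E' where E': "adjoint_pair D E'"
    using adjoint_exists[OF h D] by blast
  have "E' (h q) - E (h q) = 0" for q
    by (rule hilbert_basis_total[OF h]) (simp add: cinner_simps adjoint_pairD[OF E', symmetric] entries)
  then have "E' = E"
    using bounded_clinear_eqI[OF h adjoint_bounded_clinear[OF E' D] E] by simp
  with E' show ?thesis
    by simp
qed

section \<open>The limit matrix of a sequence of blocks\<close>

text \<open>Each block is chosen orthogonal to the finitely many vectors of all previous blocks.\<close>
lemma orthogonal_krylov_blocks:
  fixes C :: "'a::complex_inner \<Rightarrow> 'a"
  assumes inf: "\<not> (\<exists>B :: 'a set. finite B \<and> cspan B = UNIV)"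
    and C: "conjugation C" and T: "adjoint_pair T (C \<circ> T \<circ> C)"
  shows "\<exists>u. orthonormal_on {(k, i). i \<le> k} (\<lambda>(k, i). u k i) \<and> (\<forall>k. krylov_block C T {} k (u k))"
proof -
  define P :: "nat \<Rightarrow> 'a set \<times> (nat \<Rightarrow> 'a) \<Rightarrow> bool"
    where "P k s \<longleftrightarrow> finite (fst s) \<and> krylov_block C T (fst s) k (snd s)" for k s
  define Q :: "nat \<Rightarrow> 'a set \<times> (nat \<Rightarrow> 'a) \<Rightarrow> 'a set \<times> (nat \<Rightarrow> 'a) \<Rightarrow> bool"
    where "Q k s s' \<longleftrightarrow> fst s' = fst s \<union> snd s ` {..k}" for k s s'
  have "\<exists>s. P 0 s"
    using krylov_block_exists[OF inf C T, of "{}" 0] unfolding P_def by auto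
  moreover have "\<exists>s'. P (Suc k) s' \<and> Q k s s'" if "P k s" for k s
  proof -
    have "finite (fst s \<union> snd s ` {..k})"
      using that by (simp add: P_def)
    from krylov_block_exists[OF inf C T this, of "Suc k"] obtain u
      where "krylov_block C T (fst s \<union> snd s ` {..k}) (Suc k) u"
      by blast
    then show ?thesis
      using that by (intro exI[of _ "(fst s \<union> snd s ` {..k}, u)"]) (auto simp: P_def Q_def)
  qed
  ultimately obtain f where f: "\<And>k. P k (f k)" "\<And>k. Q k (f k) (f (Suc k))"
    using dependent_nat_choice[of P Q] by blast
  define u where "u k = snd (f k)" for k
  have block: "krylov_block C T (fst (f k)) k (u k)" for k
    using f(1)[of k] by (simp add: P_def u_def)
  have mem: "u k i \<in> fst (f l)" if "k < l" "i \<le> k" for k l i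
    using that(1)
  proof (induction l)
    case (Suc l)
    then show ?case
      using f(2)[of l] that(2) by (auto simp: Q_def u_def less_Suc_eq)
  qed simp
  have orth: "cinner (u l j) (u k i) = 0" if "k < l" "i \<le> k" "j \<le> l" for k l i j
    using block[of l] mem[OF that(1,2)] that(3) unfolding krylov_block_def by blast
  have same: "cinner (u k i) (u k j) = (if i = j then 1 else 0)" if "i \<le> k" "j \<le> k" for k i j
    using block[of k] that unfolding krylov_block_def using orthonormal_onD[of "{..k}" "u k" i j] by simp
  have "orthonormal_on {(k, i). i \<le> k} (\<lambda>(k, i). u k i)"
    unfolding orthonormal_on_def
  proof clarify
    fix k i l j :: nat assume *: "i \<le> k" "j \<le> l"
    then show "cinner (u k i) (u l j) = (if (k, i) = (l, j) then 1 else 0)"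
      using same[of i k j] orth[of l k j i] cinner_eq_0_commute[OF orth[of k l i j]]
      by (cases k l rule: linorder_cases) auto
  qed
  moreover have "krylov_block C T {} k (u k)" for k
    using block[of k] unfolding krylov_block_def by blast
  ultimately show ?thesis
    by blast
qed

lemma banded_combination:
  fixes y :: "nat \<Rightarrow> 'a::complex_inner"
  assumes band: "\<And>i j. 2 * i + 2 < j \<Longrightarrow> a j i = 0" and "F \<subseteq> {..m}"
  shows "(\<Sum>i\<in>F. c i *\<^sub>C (\<Sum>j\<le>2 * i + 2. a j i *\<^sub>C y j)) =
    (\<Sum>j\<le>2 * m + 2. (\<Sum>i\<in>F. c i * a j i) *\<^sub>C y j)"
proof -
  have "(\<Sum>j\<le>2 * i + 2. a j i *\<^sub>C y j) = (\<Sum>j\<le>2 * m + 2. a j i *\<^sub>C y j)" if "i \<in> F" for i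
    using assms(2) that by (intro sum.mono_neutral_left) (auto simp: band sc.zero_left)
  then have "(\<Sum>i\<in>F. c i *\<^sub>C (\<Sum>j\<le>2 * i + 2. a j i *\<^sub>C y j))
      = (\<Sum>i\<in>F. \<Sum>j\<le>2 * m + 2. (c i * a j i) *\<^sub>C y j)"
    by (intro sum.cong) (auto simp: sc.sum_right scaleC_scaleC scaleC_add_right)
  also have "\<dots> = (\<Sum>j\<le>2 * m + 2. (\<Sum>i\<in>F. c i * a j i) *\<^sub>C y j)"
    unfolding sc.sum_left by (rule sum.swap)
  finally show ?thesis .
qed

text \<open>The matrix entries of \<open>T\<close> on the blocks are bounded by \<open>K\<close>, so a diagonal subsequence makes all of
  them converge. Symmetry and the band condition pass to the limit. As \<open>T (u k i)\<close> involves only the first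
  \<open>2 * i + 3\<close> vectors of a sufficiently long block, entrywise convergence already gives convergence in norm of each
  column. The bound holds because on finitely many columns the limit matrix is a limit of compressions
  of \<open>T\<close>; whether a matrix is bounded does not depend on the orthonormal family \<open>z\<close> it acts on.\<close>
lemma limit_matrix:
  fixes C :: "'a::chilbert_space \<Rightarrow> 'a"
  assumes inf: "\<not> (\<exists>B :: 'a set. finite B \<and> cspan B = UNIV)"
    and C: "conjugation C" and T: "adjoint_pair T (C \<circ> T \<circ> C)"
    and lin: "bounded_clinear T" and K: "0 \<le> K" "\<And>x. norm (T x) \<le> K * norm x"
  shows "\<exists>u (a :: nat \<Rightarrow> nat \<Rightarrow> complex).
    orthonormal_on {(k, i). i \<le> k} (\<lambda>(k, i). u k i) \<and> (\<forall>k. \<forall>i\<le>k. C (u k i) = u k i) \<and>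
    (\<forall>i j. a j i = a i j) \<and> (\<forall>i j. 2 * i + 2 < j \<longrightarrow> a j i = 0) \<and>
    (\<forall>i. (\<lambda>k. norm (T (u k i) - (\<Sum>j\<le>2 * i + 2. a j i *\<^sub>C u k j))) \<longlonglongrightarrow> 0) \<and>
    (\<forall>z :: nat \<Rightarrow> 'a. orthonormal_on UNIV z \<longrightarrow>
       bounded_columns K (\<lambda>i. \<Sum>j\<le>2 * i + 2. a j i *\<^sub>C z j))"
proof -
  obtain v where v: "orthonormal_on {(k, i). i \<le> k} (\<lambda>(k, i). v k i)"
    "\<And>k. krylov_block C T {} k (v k)"
    using orthogonal_krylov_blocks[OF inf C T] by blast
  have Cv: "C (v k i) = v k i" if "i \<le> k" for k i
    using v(2)[of k] that unfolding krylov_block_def by blast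
  have on: "orthonormal_on {..k} (v k)" for k
    using v(2)[of k] unfolding krylov_block_def by blast
  define t where "t k = (\<lambda>(i, j). if i \<le> k \<and> j \<le> k then cinner (T (v k i)) (v k j) else 0)" for k
  have t: "norm (t k p) \<le> K" for k p
  proof (cases p)
    case (Pair i j)
    have "cmod (cinner (T (v k i)) (v k j)) \<le> K" if "i \<le> k" "j \<le> k"
      using complex_Cauchy_Schwarz[of "T (v k i)" "v k j"] K(2)[of "v k i"] that
      by (simp add: orthonormal_on_norm_one[OF on])
    then show ?thesis
      using K(1) by (simp add: t_def Pair)
  qed
  obtain r where r: "strict_mono (r :: nat \<Rightarrow> nat)" "\<And>p. \<exists>l. (\<lambda>k. t (r k) p) \<longlonglongrightarrow> l"
    by (rule function_convergent_subsequence[of UNIV t K, OF _ t]) (simp, blast)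
  then obtain l where l: "\<And>p. (\<lambda>k. t (r k) p) \<longlonglongrightarrow> l p"
    by metis
  define a where "a j i = l (i, j)" for i j
  have a: "(\<lambda>k. t (r k) (i, j)) \<longlonglongrightarrow> a j i" for i j
    using l by (simp add: a_def)
  define u where "u k = v (r k)" for k
  have rk: "k \<le> r k" for k
    using r(1) by (rule seq_suble)
  have onu: "orthonormal_on {(k, i). i \<le> k} (\<lambda>(k, i). u k i)"
    unfolding orthonormal_on_def
  proof clarify
    fix k i l j :: nat assume *: "i \<le> k" "j \<le> l"
    then have "(r k, i) \<in> {(k, i). i \<le> k}" "(r l, j) \<in> {(k, i). i \<le> k}"
      using rk[of k] rk[of l] by auto
    from orthonormal_onD[OF v(1) this]
    show "cinner (u k i) (u l j) = (if (k, i) = (l, j) then 1 else 0)"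
      using strict_mono_eq[OF r(1)] by (simp add: u_def)
  qed
  have onk: "orthonormal_on {..k} (u k)" for k
    using on[of "r k"] rk[of k] unfolding u_def by (auto intro: orthonormal_on_subset)
  have sym: "a j i = a i j" for i j
  proof -
    have "t k (i, j) = t k (j, i)" for k
    proof (cases "i \<le> k \<and> j \<le> k")
      case True
      have "cinner (T (v k i)) (v k j) = cinner (v k i) (C (T (C (v k j))))"
        using adjoint_pairD[OF T] by simp
      also have "\<dots> = cinner (C (v k i)) (C (T (v k j)))"
        using True Cv by simp
      also have "\<dots> = cinner (T (v k j)) (v k i)"
        by (rule conjugationD(4)[OF C])
      finally show ?thesis
        using True by (simp add: t_def)
    qed (auto simp: t_def)
    then show ?thesis
      using a[of i j] a[of j i] LIMSEQ_unique by auto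
  qed
  have expand: "T (u k i) = (\<Sum>j\<le>2 * i + 2. t (r k) (i, j) *\<^sub>C u k j)" if "2 * i + 2 \<le> k" for k i
  proof -
    have *: "2 * i + 2 \<le> r k"
      using that rk[of k] by simp
    have "T (v (r k) i) = (\<Sum>j\<le>2 * i + 2. cinner (T (v (r k) i)) (v (r k) j) *\<^sub>C v (r k) j)"
      by (rule krylov_block_image[OF C v(2) *])
    also have "\<dots> = (\<Sum>j\<le>2 * i + 2. t (r k) (i, j) *\<^sub>C v (r k) j)"
      using * by (intro sum.cong) (auto simp: t_def)
    finally show ?thesis
      by (simp add: u_def)
  qed
  have band: "a j i = 0" if "2 * i + 2 < j" for i j
  proof -
    have "t (r k) (i, j) = 0" if "j \<le> k" for k
    proof -
      have k: "2 * i + 2 \<le> k"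
        using \<open>2 * i + 2 < j\<close> that by simp
      have "cinner (T (u k i)) (u k j) = 0"
        unfolding expand[OF k]
        using cinner_sum_orthonormal[OF onk, of "{..2 * i + 2}" k j "\<lambda>j. t (r k) (i, j)"]
          \<open>2 * i + 2 < j\<close> that by auto
      then show ?thesis
        by (simp add: t_def u_def)
    qed
    then have "(\<lambda>k. t (r k) (i, j)) \<longlonglongrightarrow> 0"
      by (intro tendsto_eventually eventually_sequentiallyI[of j])
    then show ?thesis
      using a[of i j] LIMSEQ_unique by blast
  qed
  have err: "(\<lambda>k. norm (T (u k i) - (\<Sum>j\<le>2 * i + 2. a j i *\<^sub>C u k j))) \<longlonglongrightarrow> 0" for i
  proof (rule Lim_null_comparison)
    show "(\<lambda>k. \<Sum>j\<le>2 * i + 2. cmod (t (r k) (i, j) - a j i)) \<longlonglongrightarrow> 0"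
      by (intro tendsto_null_sum tendsto_norm_zero LIM_zero a)
    have "norm (T (u k i) - (\<Sum>j\<le>2 * i + 2. a j i *\<^sub>C u k j))
        \<le> (\<Sum>j\<le>2 * i + 2. cmod (t (r k) (i, j) - a j i))" if "2 * i + 2 \<le> k" for k
    proof -
      have "T (u k i) - (\<Sum>j\<le>2 * i + 2. a j i *\<^sub>C u k j)
          = (\<Sum>j\<le>2 * i + 2. (t (r k) (i, j) - a j i) *\<^sub>C u k j)"
        unfolding expand[OF that] by (simp add: sum_subtractf sc.diff_left)
      also have "norm \<dots> \<le> (\<Sum>j\<le>2 * i + 2. norm ((t (r k) (i, j) - a j i) *\<^sub>C u k j))"
        by (rule norm_sum)
      also have "\<dots> = (\<Sum>j\<le>2 * i + 2. cmod (t (r k) (i, j) - a j i))"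
        using that by (intro sum.cong) (auto simp: norm_scaleC orthonormal_on_norm_one[OF onk])
      finally show ?thesis .
    qed
    then show "\<forall>\<^sub>F k in sequentially. norm (norm (T (u k i) - (\<Sum>j\<le>2 * i + 2. a j i *\<^sub>C u k j)))
        \<le> (\<Sum>j\<le>2 * i + 2. cmod (t (r k) (i, j) - a j i))"
      by (intro eventually_sequentiallyI[of "2 * i + 2"]) simp
  qed
  have bound: "bounded_columns K (\<lambda>i. \<Sum>j\<le>2 * i + 2. a j i *\<^sub>C z j)"
    if z: "orthonormal_on UNIV z" for z :: "nat \<Rightarrow> 'a"
    unfolding bounded_columns_def
  proof (intro conjI allI impI)
    fix F :: "nat set" and c :: "nat \<Rightarrow> complex"
    assume "finite F"
    then obtain m where m: "F \<subseteq> {..m}"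
      using finite_nat_iff_bounded_le by blast
    define b where "b j = (\<Sum>i\<in>F. c i * a j i)" for j
    define L where "L y = (\<Sum>i\<in>F. c i *\<^sub>C (\<Sum>j\<le>2 * i + 2. a j i *\<^sub>C y j))" for y :: "nat \<Rightarrow> 'a"
    have L: "L y = (\<Sum>j\<le>2 * m + 2. b j *\<^sub>C y j)" for y
      unfolding L_def b_def by (rule banded_combination[OF band m])
    define q where "q = (\<Sum>i\<in>F. (cmod (c i))\<^sup>2)"
    have "q \<ge> 0"
      by (auto simp: q_def sum_nonneg)
    (* the combination L has the same norm on z and on the k-th block, where it is an image under T up
       to the column errors *)
    have "norm (L z) \<le> K * sqrt q + (\<Sum>i\<in>F. cmod (c i) * norm (T (u k i) - (\<Sum>j\<le>2 * i + 2. a j i *\<^sub>C u k j)))"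
      if "2 * m + 2 \<le> k" for k
    proof -
      have "(norm (L z))\<^sup>2 = (norm (L (u k)))\<^sup>2"
        unfolding L using that orthonormal_on_norm_sum[OF z, of "{..2 * m + 2}" b]
          orthonormal_on_norm_sum[OF onk[of k], of "{..2 * m + 2}" b] by (simp del: sum.atMost_Suc)
      then have "norm (L z) = norm (L (u k))"
        by (simp add: power2_eq_iff_nonneg)
      also have "L (u k) = T (\<Sum>i\<in>F. c i *\<^sub>C u k i)
          - (\<Sum>i\<in>F. c i *\<^sub>C (T (u k i) - (\<Sum>j\<le>2 * i + 2. a j i *\<^sub>C u k j)))"
        by (simp add: L_def bounded_clinearD[OF lin] sc.diff_right sum_subtractf)
      also have "norm \<dots> \<le> norm (T (\<Sum>i\<in>F. c i *\<^sub>C u k i))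
          + norm (\<Sum>i\<in>F. c i *\<^sub>C (T (u k i) - (\<Sum>j\<le>2 * i + 2. a j i *\<^sub>C u k j)))"
        by (rule norm_triangle_ineq4)
      also have "norm (\<Sum>i\<in>F. c i *\<^sub>C (T (u k i) - (\<Sum>j\<le>2 * i + 2. a j i *\<^sub>C u k j)))
          \<le> (\<Sum>i\<in>F. cmod (c i) * norm (T (u k i) - (\<Sum>j\<le>2 * i + 2. a j i *\<^sub>C u k j)))"
        unfolding norm_scaleC[symmetric] by (rule norm_sum)
      also have "norm (T (\<Sum>i\<in>F. c i *\<^sub>C u k i)) \<le> K * norm (\<Sum>i\<in>F. c i *\<^sub>C u k i)"
        by (rule K)
      also have "norm (\<Sum>i\<in>F. c i *\<^sub>C u k i) = sqrt q"
        unfolding q_def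
        by (rule real_sqrt_unique[symmetric])
          (use m that in \<open>auto intro!: orthonormal_on_norm_sum[OF onk \<open>finite F\<close>]\<close>)
      finally show ?thesis
        by simp
    qed
    then have ev: "\<exists>N. \<forall>k\<ge>N. norm (L z) \<le> K * sqrt q + (\<Sum>i\<in>F. cmod (c i) * norm (T (u k i) - (\<Sum>j\<le>2 * i + 2. a j i *\<^sub>C u k j)))"
      by blast
    have "(\<lambda>k. K * sqrt q + (\<Sum>i\<in>F. cmod (c i) * norm (T (u k i) - (\<Sum>j\<le>2 * i + 2. a j i *\<^sub>C u k j))))
        \<longlonglongrightarrow> K * sqrt q + (\<Sum>i\<in>F. cmod (c i) * 0)"
      by (intro tendsto_intros err)
    from LIMSEQ_le_const[OF this ev] have "norm (L z) \<le> K * sqrt q"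
      by simp
    then have "(norm (L z))\<^sup>2 \<le> (K * sqrt q)\<^sup>2"
      by (intro power_mono) auto
    then show "(norm (\<Sum>i\<in>F. c i *\<^sub>C (\<Sum>j\<le>2 * i + 2. a j i *\<^sub>C z j)))\<^sup>2
        \<le> K\<^sup>2 * (\<Sum>i\<in>F. (cmod (c i))\<^sup>2)"
      using \<open>q \<ge> 0\<close> by (simp add: L_def power_mult_distrib q_def)
  qed (rule K(1))
  have Cu: "C (u k i) = u k i" if "i \<le> k" for k i
    using that rk[of k] by (simp add: u_def Cv)
  from onu Cu sym band err bound show ?thesis
    by (intro exI[of _ u] exI[of _ a]) blast
qed

section \<open>Calculus of bounded columns\<close>

lemma bounded_columns_iff:
  "bounded_columns K w \<longleftrightarrow> 0 \<le> K \<and> (\<forall>F c. finite F \<longrightarrow>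
     norm (\<Sum>p\<in>F. c p *\<^sub>C w p) \<le> K * sqrt (\<Sum>p\<in>F. (cmod (c p))\<^sup>2))"
proof -
  have "a\<^sup>2 \<le> K\<^sup>2 * q \<longleftrightarrow> a \<le> K * sqrt q" if "0 \<le> K" "0 \<le> a" "0 \<le> q" for a q :: real
    using that abs_le_square_iff[of a "K * sqrt q"] by (simp add: power_mult_distrib)
  then show ?thesis
    unfolding bounded_columns_def by (auto simp: sum_nonneg)
qed

lemma bounded_columns_mono:
  fixes w :: "'i \<Rightarrow> 'a::complex_inner"
  assumes "bounded_columns K w" "K \<le> L"
  shows "bounded_columns L w"
proof -
  have "K * sqrt (\<Sum>p\<in>F. (cmod (c p))\<^sup>2) \<le> L * sqrt (\<Sum>p\<in>F. (cmod (c p))\<^sup>2)" for F and c :: "'i \<Rightarrow> complex"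
    by (rule mult_right_mono[OF assms(2)]) (simp add: sum_nonneg)
  then show ?thesis
    using assms unfolding bounded_columns_iff by (meson order_trans)
qed

lemma bounded_columns_add:
  assumes "bounded_columns K w" "bounded_columns L y"
  shows "bounded_columns (K + L) (\<lambda>p. w p + y p)"
proof -
  have "norm (\<Sum>p\<in>F. c p *\<^sub>C (w p + y p)) \<le> (K + L) * sqrt (\<Sum>p\<in>F. (cmod (c p))\<^sup>2)"
    if "finite F" for F and c :: "'a \<Rightarrow> complex"
  proof -
    have "norm (\<Sum>p\<in>F. c p *\<^sub>C (w p + y p)) \<le> norm (\<Sum>p\<in>F. c p *\<^sub>C w p) + norm (\<Sum>p\<in>F. c p *\<^sub>C y p)"
      unfolding scaleC_add_right sum.distrib by (rule norm_triangle_ineq)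
    also have "\<dots> \<le> K * sqrt (\<Sum>p\<in>F. (cmod (c p))\<^sup>2) + L * sqrt (\<Sum>p\<in>F. (cmod (c p))\<^sup>2)"
      using assms that by (auto simp: bounded_columns_iff intro!: add_mono)
    finally show ?thesis
      by (simp add: distrib_right)
  qed
  then show ?thesis
    using assms unfolding bounded_columns_iff by simp
qed

lemma bounded_columns_scaleC:
  assumes "bounded_columns K w"
  shows "bounded_columns (cmod a * K) (\<lambda>p. a *\<^sub>C w p)"
proof -
  have "norm (\<Sum>p\<in>F. c p *\<^sub>C a *\<^sub>C w p) = cmod a * norm (\<Sum>p\<in>F. c p *\<^sub>C w p)"
    for F and c :: "'a \<Rightarrow> complex"
    by (simp add: norm_scaleC[symmetric] sc.sum_right scaleC_scaleC mult.commute[of a])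
  then show ?thesis
    using assms unfolding bounded_columns_iff by (simp add: mult.assoc mult_left_mono)
qed

lemma bounded_columns_diff:
  assumes "bounded_columns K w" "bounded_columns L y"
  shows "bounded_columns (K + L) (\<lambda>p. w p - y p)"
  using bounded_columns_add[OF assms(1) bounded_columns_scaleC[OF assms(2), of "-1"]]
  by (simp add: sc.minus_left scaleC_one)

lemma bounded_columns_comp_inj:
  fixes f :: "'i \<Rightarrow> 'j"
  assumes "bounded_columns K w" "inj f"
  shows "bounded_columns K (\<lambda>p. w (f p))"
  unfolding bounded_columns_def
proof (intro conjI allI impI)
  fix F :: "'i set" and c :: "'i \<Rightarrow> complex" assume "finite F"
  have inj: "inj_on f F"
    using assms(2) by (rule inj_on_subset) simp
  show "(norm (\<Sum>p\<in>F. c p *\<^sub>C w (f p)))\<^sup>2 \<le> K\<^sup>2 * (\<Sum>p\<in>F. (cmod (c p))\<^sup>2)"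
    using bounded_columnsD[OF assms(1), of "f ` F" "\<lambda>q. c (inv f q)"] \<open>finite F\<close>
    by (simp add: sum.reindex[OF inj] inv_f_f[OF assms(2)])
qed (use assms(1) in \<open>simp add: bounded_columns_def\<close>)

lemma bounded_columns_geometric:
  fixes w :: "'i \<Rightarrow> 'a::complex_inner"
  assumes "inj e" "\<And>p. norm (w p) \<le> (1/2) ^ e p"
  shows "bounded_columns 2 w"
proof -
  have "norm (\<Sum>p\<in>F. c p *\<^sub>C w p) \<le> 2 * sqrt (\<Sum>p\<in>F. (cmod (c p))\<^sup>2)"
    if "finite F" for F and c :: "'i \<Rightarrow> complex"
  proof -
    define q where "q = sqrt (\<Sum>p\<in>F. (cmod (c p))\<^sup>2)"
    have q: "cmod (c p) \<le> q" if "p \<in> F" for p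
      unfolding q_def using that \<open>finite F\<close>
      by (intro real_le_rsqrt member_le_sum) auto
    have "q \<ge> 0"
      by (simp add: q_def sum_nonneg)
    have "(\<Sum>p\<in>F. (1/2::real) ^ e p) = (\<Sum>k\<in>e ` F. (1/2) ^ k)"
      using assms(1) by (subst sum.reindex) (auto intro: inj_on_subset)
    also have "\<dots> \<le> (\<Sum>k. (1/2) ^ k)"
      using that by (intro sum_le_suminf) (auto intro: summable_geometric)
    also have "\<dots> = 2"
      by (simp add: suminf_geometric)
    finally have geo: "(\<Sum>p\<in>F. (1/2::real) ^ e p) \<le> 2" .
    have "norm (\<Sum>p\<in>F. c p *\<^sub>C w p) \<le> (\<Sum>p\<in>F. cmod (c p) * norm (w p))"
      unfolding norm_scaleC[symmetric] by (rule norm_sum)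
    also have "\<dots> \<le> (\<Sum>p\<in>F. q * (1/2) ^ e p)"
      using q assms(2) \<open>q \<ge> 0\<close> by (intro sum_mono mult_mono) auto
    also have "\<dots> \<le> q * 2"
      unfolding sum_distrib_left[symmetric] using geo \<open>q \<ge> 0\<close> by (rule mult_left_mono)
    finally show ?thesis
      by (simp add: q_def)
  qed
  then show ?thesis
    unfolding bounded_columns_iff by simp
qed

text \<open>If the columns of different groups are orthogonal, the operator is an orthogonal direct sum as far
  as its values are concerned, and its norm is the supremum over the groups.\<close>
lemma bounded_columns_groupwise:
  fixes y :: "'i \<Rightarrow> 'a::complex_inner" and g :: "'i \<Rightarrow> 'l"
  assumes "0 \<le> K" and orth: "\<And>p q. g p \<noteq> g q \<Longrightarrow> cinner (y p) (y q) = 0"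
    and group: "\<And>l F c. finite F \<Longrightarrow> F \<subseteq> {p. g p = l} \<Longrightarrow>
      (norm (\<Sum>p\<in>F. c p *\<^sub>C y p))\<^sup>2 \<le> K\<^sup>2 * (\<Sum>p\<in>F. (cmod (c p))\<^sup>2)"
  shows "bounded_columns K y"
  unfolding bounded_columns_def
proof (intro conjI allI impI)
  fix F :: "'i set" and c :: "'i \<Rightarrow> complex" assume F: "finite F"
  have "(norm (\<Sum>p\<in>F. c p *\<^sub>C y p))\<^sup>2 = (norm (\<Sum>l\<in>g ` F. \<Sum>p\<in>{p\<in>F. g p = l}. c p *\<^sub>C y p))\<^sup>2"
    by (subst sum.image_gen[OF F, of _ g]) simp
  also have "\<dots> = (\<Sum>l\<in>g ` F. (norm (\<Sum>p\<in>{p\<in>F. g p = l}. c p *\<^sub>C y p))\<^sup>2)"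
    using F by (intro Pythagoras_sum) (auto simp: cinner_simps intro!: sum.neutral orth)
  also have "\<dots> \<le> (\<Sum>l\<in>g ` F. K\<^sup>2 * (\<Sum>p\<in>{p\<in>F. g p = l}. (cmod (c p))\<^sup>2))"
    using F by (intro sum_mono group) auto
  also have "\<dots> = K\<^sup>2 * (\<Sum>p\<in>F. (cmod (c p))\<^sup>2)"
    unfolding sum_distrib_left[symmetric] using sum.image_gen[OF F, of "\<lambda>p. (cmod (c p))\<^sup>2" g] by simp
  finally show "(norm (\<Sum>p\<in>F. c p *\<^sub>C y p))\<^sup>2 \<le> K\<^sup>2 * (\<Sum>p\<in>F. (cmod (c p))\<^sup>2)" .
qed (rule assms(1))

lemma bounded_columns_prod:
  fixes y :: "'i \<times> 'm \<Rightarrow> 'a::complex_inner"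
  assumes orth: "\<And>p q. snd p \<noteq> snd q \<Longrightarrow> cinner (y p) (y q) = 0"
    and col: "\<And>m. bounded_columns K (\<lambda>i. y (i, m))"
  shows "bounded_columns K y"
proof (rule bounded_columns_groupwise[where g=snd])
  fix m :: 'm and F :: "('i \<times> 'm) set" and c assume F: "finite F" "F \<subseteq> {p. snd p = m}"
  have inj: "inj_on (\<lambda>i. (i, m)) (fst ` F)"
    by (simp add: inj_on_def)
  have eq: "F = (\<lambda>i. (i, m)) ` fst ` F"
    using F(2) by force
  have "(\<Sum>p\<in>F. c p *\<^sub>C y p) = (\<Sum>i\<in>fst ` F. c (i, m) *\<^sub>C y (i, m))"
    "(\<Sum>p\<in>F. (cmod (c p))\<^sup>2) = (\<Sum>i\<in>fst ` F. (cmod (c (i, m)))\<^sup>2)"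
    by (subst (1) eq, simp only: sum.reindex[OF inj] o_def)+
  then show "(norm (\<Sum>p\<in>F. c p *\<^sub>C y p))\<^sup>2 \<le> K\<^sup>2 * (\<Sum>p\<in>F. (cmod (c p))\<^sup>2)"
    using bounded_columnsD[OF col[of m], of "fst ` F"] F(1) by simp
qed (use orth col in \<open>auto simp: bounded_columns_def\<close>)

text \<open>The part of a matrix that sends the indices of group \<open>l\<close> to the indices in \<open>J l\<close> is no larger than
  the matrix itself when the sets \<open>J l\<close> are disjoint: on one group it is the matrix followed by a
  projection, and different groups have orthogonal images.\<close>
lemma bounded_columns_block_part:
  fixes z :: "nat \<Rightarrow> 'a::complex_inner" and g :: "nat \<Rightarrow> 'l"
  assumes band: "\<And>i j. 2 * i + 2 < j \<Longrightarrow> a j i = 0"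
    and z: "orthonormal_on UNIV z"
    and A: "bounded_columns K (\<lambda>i. \<Sum>j\<le>2 * i + 2. a j i *\<^sub>C z j)"
    and J: "\<And>l l'. l \<noteq> l' \<Longrightarrow> J l \<inter> J l' = {}"
  shows "bounded_columns K (\<lambda>i. \<Sum>j\<le>2 * i + 2. (if j \<in> J (g i) then a j i else 0) *\<^sub>C z j)"
proof (rule bounded_columns_groupwise[where g=g])
  show "0 \<le> K"
    using A by (simp add: bounded_columns_def)
  show "cinner (\<Sum>j\<le>2 * p + 2. (if j \<in> J (g p) then a j p else 0) *\<^sub>C z j)
      (\<Sum>j\<le>2 * q + 2. (if j \<in> J (g q) then a j q else 0) *\<^sub>C z j) = 0" if "g p \<noteq> g q" for p q
    unfolding ci.sum_left ci.sum_right using J[OF that]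
    by (intro sum.neutral ballI) (auto simp: cinner_simps z[unfolded orthonormal_on_def])
  fix l and F :: "nat set" and c assume F: "finite F" "F \<subseteq> {p. g p = l}"
  then obtain m where m: "F \<subseteq> {..m}"
    using finite_nat_iff_bounded_le by blast
  define b where "b j = (\<Sum>i\<in>F. c i * a j i)" for j
  have "(\<Sum>i\<in>F. c i *\<^sub>C (\<Sum>j\<le>2 * i + 2. (if j \<in> J (g i) then a j i else 0) *\<^sub>C z j))
      = (\<Sum>i\<in>F. c i *\<^sub>C (\<Sum>j\<le>2 * i + 2. (if j \<in> J l then a j i else 0) *\<^sub>C z j))"
    using F(2) by (intro sum.cong) auto
  also have "\<dots> = (\<Sum>j\<le>2 * m + 2. (\<Sum>i\<in>F. c i * (if j \<in> J l then a j i else 0)) *\<^sub>C z j)"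
    by (rule banded_combination[OF _ m]) (simp add: band)
  also have "\<dots> = (\<Sum>j\<le>2 * m + 2. (if j \<in> J l then b j else 0) *\<^sub>C z j)"
    by (intro sum.cong) (auto simp: b_def)
  also have "(norm \<dots>)\<^sup>2 = (\<Sum>j\<le>2 * m + 2. (cmod (if j \<in> J l then b j else 0))\<^sup>2)"
    by (rule orthonormal_on_norm_sum[OF z]) auto
  also have "\<dots> \<le> (\<Sum>j\<le>2 * m + 2. (cmod (b j))\<^sup>2)"
    by (intro sum_mono) auto
  also have "\<dots> = (norm (\<Sum>j\<le>2 * m + 2. b j *\<^sub>C z j))\<^sup>2"
    by (rule orthonormal_on_norm_sum[OF z, symmetric]) auto
  also have "(\<Sum>j\<le>2 * m + 2. b j *\<^sub>C z j) = (\<Sum>i\<in>F. c i *\<^sub>C (\<Sum>j\<le>2 * i + 2. a j i *\<^sub>C z j))"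
    unfolding b_def by (rule banded_combination[OF band m, symmetric])
  also have "(norm \<dots>)\<^sup>2 \<le> K\<^sup>2 * (\<Sum>p\<in>F. (cmod (c p))\<^sup>2)"
    by (rule bounded_columnsD[OF A F(1)])
  finally show "(norm (\<Sum>i\<in>F. c i *\<^sub>C (\<Sum>j\<le>2 * i + 2. (if j \<in> J (g i) then a j i else 0) *\<^sub>C z j)))\<^sup>2
      \<le> K\<^sup>2 * (\<Sum>p\<in>F. (cmod (c p))\<^sup>2)" .
qed

section \<open>An approximate intertwiner\<close>

text \<open>The generations of the binary tree in which \<open>i\<close> has the children \<open>2 * i + 1\<close> and \<open>2 * i + 2\<close>:
  level \<open>l\<close> consists of the indices from \<open>2 ^ l - 1\<close> to \<open>2 ^ (l + 1) - 2\<close>. A symmetric matrix with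
  \<open>a j i = 0\<close> for \<open>j > 2 * i + 2\<close> therefore connects only equal or adjacent levels.\<close>
fun level :: "nat \<Rightarrow> nat" where
  "level 0 = 0"
| "level (Suc i) = Suc (level (i div 2))"

lemma level_mono: "i \<le> j \<Longrightarrow> level i \<le> level j"
proof (induction j arbitrary: i rule: level.induct)
  case (2 j)
  then show ?case
    by (cases i) (auto intro: div_le_mono)
qed simp

lemma level_double: "level (2 * i + 2) = Suc (level i)"
  using level.simps(2)[of "2 * i + 1"] by simp

lemma level_le_Suc: "j \<le> 2 * i + 2 \<Longrightarrow> level j \<le> Suc (level i)"
  using level_mono[of j "2 * i + 2"] level_double by simp

lemma level_power_bound: "i + 2 \<le> 2 ^ Suc (level i)"
proof (induction i rule: level.induct)
  case (2 i)
  have "Suc i + 2 \<le> 2 * (i div 2 + 2)"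
    by presburger
  also have "\<dots> \<le> 2 * 2 ^ Suc (level (i div 2))"
    using "2.IH" by (rule mult_left_mono) simp
  finally show ?case
    by simp
qed simp

lemma finite_level_le: "finite {i. level i \<le> n}"
proof (rule finite_subset)
  show "{i. level i \<le> n} \<subseteq> {..<2 ^ Suc n}"
  proof
    fix i assume "i \<in> {i. level i \<le> n}"
    then have "level i \<le> n"
      by simp
    have "i < 2 ^ Suc (level i)"
      using level_power_bound[of i] by linarith
    also have "\<dots> \<le> (2::nat) ^ Suc n"
      using \<open>level i \<le> n\<close> by (intro power_increasing) auto
    finally show "i \<in> {..<2 ^ Suc n}"
      by simp
  qed
qed simp

lemma strict_mono_above:
  fixes k :: "nat \<Rightarrow> nat"
  shows "\<exists>r. strict_mono r \<and> (\<forall>b. k b \<le> r b)"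
proof (intro exI conjI allI)
  show "strict_mono (\<lambda>b. b + (\<Sum>c\<le>b. k c))"
    by (simp add: strict_mono_Suc_iff)
  show "k b \<le> b + (\<Sum>c\<le>b. k c)" for b
    using member_le_sum[of b "{..b}" k] by simp
qed

text \<open>Moving a window of length \<open>N\<close> by one step changes the sum only at the two ends of the window.\<close>
lemma window_sum_diff:
  fixes f :: "nat \<Rightarrow> 'b::ab_group_add"
  assumes "1 \<le> N"
  shows "(\<Sum>n\<in>{l..<l + N}. f n) - (\<Sum>n\<in>{Suc l..<Suc l + N}. f n) = f l - f (l + N)"
proof -
  have "(\<Sum>n\<in>{l..<l + N}. f n) = f l + (\<Sum>n\<in>{Suc l..<l + N}. f n)"
    using assms by (intro sum.atLeast_Suc_lessThan) simp
  moreover have "(\<Sum>n\<in>{Suc l..<Suc l + N}. f n) = (\<Sum>n\<in>{Suc l..<l + N}. f n) + f (l + N)"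
    using assms by simp
  ultimately show ?thesis
    by simp
qed

text \<open>The pair \<open>(i, m)\<close> stands for the index \<open>i\<close> in the \<open>m\<close>-th copy of the limit matrix. The vector
  \<open>v (i, m)\<close> is the normalised sum of the \<open>i\<close>-th vectors of the blocks \<open>\<kappa> n m\<close> for \<open>n\<close> in a window of
  length \<open>N\<close> that starts at the level of \<open>i\<close>; the blocks for different \<open>(n, m)\<close> are different, whence
  orthonormality. The error has two sources. The blocks realise the limit matrix only approximately,
  which is made summable by taking them far out in the sequence. And the windows of \<open>i\<close> and \<open>j\<close> differ when their
  levels do. For adjacent levels two boundary terms remain for each of the two directions; each of
  these four parts is a piece of the limit matrix acting on an orthonormal family, hence bounded by \<open>K\<close>.
  The normalisation \<open>1 / sqrt N\<close> makes everything small.\<close>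
lemma approximate_intertwiner:
  fixes C :: "'a::chilbert_space \<Rightarrow> 'a" and a :: "nat \<Rightarrow> nat \<Rightarrow> complex"
  assumes C: "conjugation C" and lin: "bounded_clinear T"
    and on: "orthonormal_on {(k, i). i \<le> k} (\<lambda>(k, i). u k i)"
    and Cu: "\<And>k i. i \<le> k \<Longrightarrow> C (u k i) = u k i"
    and sym: "\<And>i j. a j i = a i j" and band: "\<And>i j. 2 * i + 2 < j \<Longrightarrow> a j i = 0"
    and err: "\<And>i. (\<lambda>k. norm (T (u k i) - (\<Sum>j\<le>2 * i + 2. a j i *\<^sub>C u k j))) \<longlonglongrightarrow> 0"
    and A: "\<And>z :: nat \<Rightarrow> 'a. orthonormal_on UNIV z \<Longrightarrow>
       bounded_columns K (\<lambda>i. \<Sum>j\<le>2 * i + 2. a j i *\<^sub>C z j)"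
    and "\<epsilon> > 0"
  shows "\<exists>v :: nat \<times> nat \<Rightarrow> 'a. orthonormal_on UNIV v \<and> (\<forall>p. C (v p) = v p) \<and>
    bounded_columns \<epsilon> (\<lambda>(i, m). T (v (i, m)) - (\<Sum>j\<le>2 * i + 2. a j i *\<^sub>C v (j, m)))"
proof -
  (* 2 bounds the summed block errors, and each of the four boundary parts contributes K *)
  obtain N :: nat where N: "1 \<le> N" "(2 + 4 * K) / sqrt N \<le> \<epsilon>"
  proof -
    have "(\<lambda>N. (2 + 4 * K) / sqrt (real N)) \<longlonglongrightarrow> 0"
      by (intro real_tendsto_divide_at_top[OF tendsto_const] filterlim_compose[OF sqrt_at_top]
          filterlim_real_sequentially)
    then have "\<forall>\<^sub>F N in sequentially. (2 + 4 * K) / sqrt (real N) < \<epsilon> \<and> 1 \<le> N"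
      using \<open>\<epsilon> > 0\<close> by (intro eventually_conj order_tendstoD(2) eventually_ge_at_top)
    then show ?thesis
      using that eventually_happens[of _ sequentially] by force
  qed
  (* how far the k-th block is from realising the i-th column of the limit matrix *)
  define res where "res k i = norm (T (u k i) - (\<Sum>j\<le>2 * i + 2. a j i *\<^sub>C u k j))" for k i
  have "\<exists>k0. \<forall>k\<ge>k0. (\<forall>i. level i \<le> Suc n \<longrightarrow> i \<le> k) \<and>
      (\<forall>i. level i \<le> n \<longrightarrow> res k i \<le> (1/2) ^ prod_encode (i, m) / N)" for n m
  proof -
    have "\<forall>\<^sub>F k in sequentially. \<forall>i\<in>{i. level i \<le> n}. res k i < (1/2) ^ prod_encode (i, m) / N"
      using N(1) err
      by (intro eventually_ball_finite finite_level_le ballI order_tendstoD(2)[of _ 0]) (auto simp: res_def)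
    moreover have "\<forall>\<^sub>F k in sequentially. \<forall>i\<in>{i. level i \<le> Suc n}. i \<le> k"
      by (intro eventually_ball_finite finite_level_le ballI eventually_ge_at_top)
    ultimately have "\<forall>\<^sub>F k in sequentially. (\<forall>i. level i \<le> Suc n \<longrightarrow> i \<le> k) \<and>
      (\<forall>i. level i \<le> n \<longrightarrow> res k i \<le> (1/2) ^ prod_encode (i, m) / N)"
      by eventually_elim (auto simp: less_imp_le)
    then show ?thesis
      by (simp add: eventually_sequentially)
  qed
  then obtain k0 where k0: "\<And>n m k. k0 n m \<le> k \<Longrightarrow> (\<forall>i. level i \<le> Suc n \<longrightarrow> i \<le> k) \<and>
      (\<forall>i. level i \<le> n \<longrightarrow> res k i \<le> (1/2) ^ prod_encode (i, m) / N)"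
    by metis
  obtain r where r: "strict_mono r" "\<And>b. (case prod_decode b of (n, m) \<Rightarrow> k0 n m) \<le> r b"
    using strict_mono_above[of "\<lambda>b. case prod_decode b of (n, m) \<Rightarrow> k0 n m"] by blast
  (* the block of the window position n in the copy m; it contains all indices up to level n + 1,
     since T moves the indices of level n that far *)
  define \<kappa> where "\<kappa> n m = r (prod_encode (n, m))" for n m
  have \<kappa>_inj: "\<kappa> n m = \<kappa> n' m' \<longleftrightarrow> n = n' \<and> m = m'" for n m n' m'
    using strict_mono_eq[OF r(1)] by (simp add: \<kappa>_def)
  have \<kappa>0: "k0 n m \<le> \<kappa> n m" for n m
    using r(2)[of "prod_encode (n, m)"] by (simp add: \<kappa>_def)
  have \<kappa>1: "level i \<le> Suc n \<Longrightarrow> i \<le> \<kappa> n m" for i n m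
    using k0[OF \<kappa>0[of n m]] by simp
  have \<kappa>2: "level i \<le> n \<Longrightarrow> res (\<kappa> n m) i \<le> (1/2) ^ prod_encode (i, m) / N" for i n m
    using k0[OF \<kappa>0[of n m]] by blast
  define w where "w n m i = u (\<kappa> n m) i" for n m i
  have ww: "cinner (w n m i) (w n' m' i') = (if n = n' \<and> m = m' \<and> i = i' then 1 else 0)"
    if "level i \<le> Suc n" "level i' \<le> Suc n'" for n m i n' m' i'
    using orthonormal_onD[OF on, of "(\<kappa> n m, i)" "(\<kappa> n' m', i')"] \<kappa>1[OF that(1)] \<kappa>1[OF that(2)]
    by (auto simp: w_def \<kappa>_inj)
  have Cw: "C (w n m i) = w n m i" if "level i \<le> Suc n" for n m i
    using Cu[OF \<kappa>1[OF that]] by (simp add: w_def)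
  define s where "s = complex_of_real (1 / sqrt N)"
  define v where "v = (\<lambda>(i, m). s *\<^sub>C (\<Sum>n\<in>{level i..<level i + N}. w n m i))"
  have "orthonormal_on UNIV v"
    unfolding orthonormal_on_def
  proof clarify
    fix i m i' m'
    have "cinner (v (i, m)) (v (i', m')) = s * cnj s *
        (\<Sum>n\<in>{level i..<level i + N}. \<Sum>n'\<in>{level i'..<level i' + N}. cinner (w n m i) (w n' m' i'))"
      unfolding ci.sum_right[symmetric] ci.sum_left[symmetric]
      by (simp add: v_def cinner_scaleC_left cinner_scaleC_right mult.assoc)
    also have "\<dots> = s * cnj s * (\<Sum>n\<in>{level i..<level i + N}. if (i, m) = (i', m') then 1 else 0)"
      by (intro arg_cong2[of _ _ _ _ times] refl sum.cong) (auto simp: ww)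
    also have "\<dots> = (if (i, m) = (i', m') then 1 else 0)"
      using N(1) by (simp add: s_def flip: of_real_mult)
    finally show "cinner (v (i, m)) (v (i', m')) = (if (i, m) = (i', m') then 1 else 0)" .
  qed
  moreover have "C (v p) = v p" for p
  proof (cases p)
    case (Pair i m)
    have "(\<Sum>n\<in>{level i..<level i + N}. C (w n m i)) = (\<Sum>n\<in>{level i..<level i + N}. w n m i)"
      by (intro sum.cong) (auto simp: Cw)
    then show ?thesis
      by (simp add: Pair v_def conjugationD[OF C] s_def)
  qed
  moreover have "bounded_columns \<epsilon> (\<lambda>(i, m). T (v (i, m)) - (\<Sum>j\<le>2 * i + 2. a j i *\<^sub>C v (j, m)))"
  proof -
    define \<rho> where "\<rho> = (\<lambda>(i, m). \<Sum>n\<in>{level i..<level i + N}.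
      (T (w n m i) - (\<Sum>j\<le>2 * i + 2. a j i *\<^sub>C w n m j)))"
    have \<rho>: "bounded_columns 2 \<rho>"
    proof (rule bounded_columns_geometric[OF inj_prod_encode])
      fix p :: "nat \<times> nat"
      obtain i m where p: "p = (i, m)"
        by (cases p)
      have "norm (\<rho> p) \<le> (\<Sum>n\<in>{level i..<level i + N}. res (\<kappa> n m) i)"
        unfolding \<rho>_def p by (simp add: res_def w_def del: sum.atMost_Suc) (rule norm_sum)
      also have "\<dots> \<le> (\<Sum>n\<in>{level i..<level i + N}. (1/2) ^ prod_encode (i, m) / N)"
        by (intro sum_mono \<kappa>2) auto
      also have "\<dots> = (1/2) ^ prod_encode p"
        using N(1) by (simp add: p)
      finally show "norm (\<rho> p) \<le> (1/2) ^ prod_encode p" .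
    qed
    (* one kind of boundary term: entries from the level l into J l, landing in the block at window
       position \<sigma> j; the families below have \<sigma> j one less than level j at worst *)
    define part where "part J \<sigma> = (\<lambda>(i, m). \<Sum>j\<le>2 * i + 2.
      (if j \<in> J (level i) then a j i else 0) *\<^sub>C w (\<sigma> j) m j)" for J :: "nat \<Rightarrow> nat set" and \<sigma>
    have part: "bounded_columns K (part J \<sigma>)"
      if \<sigma>: "\<And>j. level j \<le> Suc (\<sigma> j)" and J: "\<And>l l'. l \<noteq> l' \<Longrightarrow> J l \<inter> J l' = {}" for J \<sigma>
    proof (rule bounded_columns_prod)
      show "cinner (part J \<sigma> p) (part J \<sigma> q) = 0" if "snd p \<noteq> snd q" for p q
        using that unfolding part_def
        by (simp add: case_prod_unfold ci.sum_left ci.sum_right del: sum.atMost_Suc)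
          (intro sum.neutral ballI, simp add: cinner_simps ww \<sigma>)
      fix m
      have "orthonormal_on UNIV (\<lambda>j. w (\<sigma> j) m j)"
        unfolding orthonormal_on_def using \<sigma> by (auto simp: ww)
      from bounded_columns_block_part[where J=J and g=level, OF band this A[OF this] J]
      show "bounded_columns K (\<lambda>i. part J \<sigma> (i, m))"
        by (simp add: part_def del: sum.atMost_Suc)
    qed
    define up where "up l = {j. level j = Suc l}" for l
    define down where "down l = {j. Suc (level j) = l}" for l
    have up: "up l \<inter> up l' = {}" and down: "down l \<inter> down l' = {}" if "l \<noteq> l'" for l l'
      using that by (auto simp: up_def down_def)
    have eq: "T (v (i, m)) - (\<Sum>j\<le>2 * i + 2. a j i *\<^sub>C v (j, m)) = s *\<^sub>C (\<rho> (i, m)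
        + ((part up (\<lambda>j. level j - 1) (i, m) - part up (\<lambda>j. level j - 1 + N) (i, m))
        - (part down (\<lambda>j. level j) (i, m) - part down (\<lambda>j. level j + N) (i, m))))" for i m
    proof -
      let ?I = "\<lambda>i. {level i..<level i + N}"
      have "T (v (i, m)) = s *\<^sub>C (\<Sum>n\<in>?I i. T (w n m i))"
        by (simp add: v_def bounded_clinearD[OF lin])
      also have "\<dots> = s *\<^sub>C (\<rho> (i, m) + (\<Sum>n\<in>?I i. \<Sum>j\<le>2 * i + 2. a j i *\<^sub>C w n m j))"
        by (simp add: \<rho>_def sum_subtractf del: sum.atMost_Suc)
      also have "(\<Sum>n\<in>?I i. \<Sum>j\<le>2 * i + 2. a j i *\<^sub>C w n m j)
          = (\<Sum>j\<le>2 * i + 2. a j i *\<^sub>C (\<Sum>n\<in>?I i. w n m j))"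
        unfolding sc.sum_right by (rule sum.swap)
      finally have 1: "T (v (i, m)) = s *\<^sub>C (\<rho> (i, m) + (\<Sum>j\<le>2 * i + 2. a j i *\<^sub>C (\<Sum>n\<in>?I i. w n m j)))" .
      have 2: "(\<Sum>j\<le>2 * i + 2. a j i *\<^sub>C v (j, m)) = s *\<^sub>C (\<Sum>j\<le>2 * i + 2. a j i *\<^sub>C (\<Sum>n\<in>?I j. w n m j))"
        unfolding sc.sum_right[of s]
        by (intro sum.cong refl) (simp add: v_def scaleC_scaleC mult.commute)
      (* end points of the windows that do not cancel: for j one level above i these are the positions
         level i = level j - 1 and level i + N, for j one level below i they are level j and level j + N *)
      have 3: "a j i *\<^sub>C (\<Sum>n\<in>?I i. w n m j) - a j i *\<^sub>C (\<Sum>n\<in>?I j. w n m j) =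
        ((if j \<in> up (level i) then a j i else 0) *\<^sub>C w (level j - 1) m j
          - (if j \<in> up (level i) then a j i else 0) *\<^sub>C w (level j - 1 + N) m j)
        - ((if j \<in> down (level i) then a j i else 0) *\<^sub>C w (level j) m j
          - (if j \<in> down (level i) then a j i else 0) *\<^sub>C w (level j + N) m j)"
        if "j \<le> 2 * i + 2" for j
      proof (cases "a j i = 0")
        case False
        then have "i \<le> 2 * j + 2"
          using band[of j i] sym[of i j] by force
        with that have "level j \<le> Suc (level i)" "level i \<le> Suc (level j)"
          by (auto intro: level_le_Suc)
        then consider "level j = level i" | "level j = Suc (level i)" | "level i = Suc (level j)"
          by linarith
        then show ?thesis
        proof cases
          case 2
          have "a j i *\<^sub>C (\<Sum>n\<in>?I i. w n m j) - a j i *\<^sub>C (\<Sum>n\<in>?I j. w n m j)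
              = a j i *\<^sub>C (w (level i) m j - w (level i + N) m j)"
            unfolding sc.diff_right[symmetric]
              window_sum_diff[OF N(1), of "\<lambda>n. w n m j" "level i", folded 2] ..
          then show ?thesis
            by (simp add: up_def down_def 2 sc.zero_left sc.diff_right)
        next
          case 3
          have "(\<Sum>n\<in>?I i. w n m j) - (\<Sum>n\<in>?I j. w n m j) = w (level j + N) m j - w (level j) m j"
            using window_sum_diff[OF N(1), of "\<lambda>n. w n m j" "level j", folded 3] minus_diff_eq by metis
          then have "a j i *\<^sub>C (\<Sum>n\<in>?I i. w n m j) - a j i *\<^sub>C (\<Sum>n\<in>?I j. w n m j)
              = a j i *\<^sub>C (w (level j + N) m j - w (level j) m j)"
            by (simp only: sc.diff_right[symmetric])
          then show ?thesis
            by (simp add: up_def down_def 3 sc.zero_left sc.diff_right)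
        qed (simp add: up_def down_def sc.zero_left)
      qed (simp add: sc.zero_left)
      have "T (v (i, m)) - (\<Sum>j\<le>2 * i + 2. a j i *\<^sub>C v (j, m)) = s *\<^sub>C (\<rho> (i, m)
        + (\<Sum>j\<le>2 * i + 2. a j i *\<^sub>C (\<Sum>n\<in>?I i. w n m j) - a j i *\<^sub>C (\<Sum>n\<in>?I j. w n m j)))"
        unfolding 1 2 by (simp only: sum_subtractf sc.diff_right add_diff_eq)
      also have "(\<Sum>j\<le>2 * i + 2. a j i *\<^sub>C (\<Sum>n\<in>?I i. w n m j) - a j i *\<^sub>C (\<Sum>n\<in>?I j. w n m j))
        = (part up (\<lambda>j. level j - 1) (i, m) - part up (\<lambda>j. level j - 1 + N) (i, m))
        - (part down (\<lambda>j. level j) (i, m) - part down (\<lambda>j. level j + N) (i, m))"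
        unfolding part_def case_prod_conv sum_subtractf[symmetric]
        by (intro sum.cong refl 3) simp
      finally show ?thesis .
    qed
    have "bounded_columns (cmod s * (2 + ((K + K) + (K + K)))) (\<lambda>p. s *\<^sub>C (\<rho> p
        + ((part up (\<lambda>j. level j - 1) p - part up (\<lambda>j. level j - 1 + N) p)
        - (part down (\<lambda>j. level j) p - part down (\<lambda>j. level j + N) p))))"
      by (intro bounded_columns_scaleC bounded_columns_add bounded_columns_diff \<rho> part up down) auto
    moreover have "cmod s * (2 + ((K + K) + (K + K))) = (2 + 4 * K) / sqrt N"
      by (simp add: s_def norm_divide)
    ultimately have "bounded_columns ((2 + 4 * K) / sqrt N) (\<lambda>(i, m). T (v (i, m)) - (\<Sum>j\<le>2 * i + 2. a j i *\<^sub>C v (j, m)))"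
      unfolding eq by (simp add: case_prod_unfold)
    then show ?thesis
      using N(2) by (rule bounded_columns_mono)
  qed
  ultimately show ?thesis
    by blast
qed

section \<open>Absorbing a multiple of the limit operator\<close>

lemma orthonormal_on_comp_inj:
  assumes "orthonormal_on UNIV v" "inj f"
  shows "orthonormal_on UNIV (\<lambda>p. v (f p))"
  unfolding orthonormal_on_def
proof (intro ballI)
  show "cinner (v (f p)) (v (f q)) = (if p = q then 1 else 0)" for p q
    using orthonormal_onD[OF assms(1), of "f p" "f q"] by (simp add: inj_eq[OF assms(2)])
qed

lemma bounded_clinear_compose: "bounded_clinear D \<Longrightarrow> bounded_clinear E \<Longrightarrow> bounded_clinear (\<lambda>x. D (E x))"
  unfolding bounded_clinear_def by (simp add: bounded_linear_compose)

lemma bounded_clinear_add: "bounded_clinear D \<Longrightarrow> bounded_clinear E \<Longrightarrow> bounded_clinear (\<lambda>x. D x + E x)"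
  unfolding bounded_clinear_def by (simp add: bounded_linear_add scaleC_add_right)

lemma bounded_clinear_diff: "bounded_clinear D \<Longrightarrow> bounded_clinear E \<Longrightarrow> bounded_clinear (\<lambda>x. D x - E x)"
  unfolding bounded_clinear_def by (simp add: bounded_linear_sub sc.diff_right)

lemma bounded_clinear_ident: "bounded_clinear (\<lambda>x. x)"
  unfolding bounded_clinear_def by simp

lemma bounded_clinear_zero: "bounded_clinear (\<lambda>x. 0)"
  unfolding bounded_clinear_def by (simp add: sc.zero_right)

lemmas bounded_clinear_intros = bounded_clinear_add bounded_clinear_diff
  bounded_clinear_ident bounded_clinear_zero

lemma bounded_clinear_conj:
  assumes "conjugation C" "bounded_clinear D"
  shows "bounded_clinear (\<lambda>x. C (D (C x)))"
  using bounded_linear_compose[OF conjugationD(10)[OF assms(1)]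
    bounded_linear_compose[OF bounded_clinearD(1)[OF assms(2)] conjugationD(10)[OF assms(1)]]]
  unfolding bounded_clinear_def
  by (simp add: conjugationD[OF assms(1)] bounded_clinearD[OF assms(2)])

lemma adjoint_pair_conj:
  assumes C: "conjugation C" and D: "adjoint_pair D E"
  shows "adjoint_pair (\<lambda>x. C (D (C x))) (\<lambda>x. C (E (C x)))"
  unfolding adjoint_pair_def
proof (intro allI)
  fix x y
  have "cinner (C (D (C x))) y = cinner (C y) (D (C x))"
    by (rule conjugationD(5)[OF C])
  also have "\<dots> = cinner (E (C y)) (C x)"
    by (rule adjoint_pairD'[OF D, symmetric])
  also have "\<dots> = cinner (C (C x)) (C (E (C y)))"
    by (rule conjugationD(4)[OF C, symmetric])
  also have "\<dots> = cinner x (C (E (C y)))"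
    by (simp add: conjugationD(3)[OF C])
  finally show "cinner (C (D (C x))) y = cinner x (C (E (C y)))" .
qed

lemma bounded_clinear_eq_by_entries:
  fixes h :: "nat \<Rightarrow> 'a::chilbert_space"
  assumes h: "hilbert_basis h" and "bounded_clinear D" "bounded_clinear E"
    and entries: "\<And>p q. cinner (D (h p)) (h q) = cinner (E (h p)) (h q)"
  shows "D = E"
proof (rule bounded_clinear_eqI[OF h assms(2,3)])
  fix p
  have "cinner (D (h p) - E (h p)) (h q) = 0" for q
    by (simp add: cinner_simps entries)
  from hilbert_basis_total[OF h cinner_eq_0_commute[OF this]] have "D (h p) - E (h p) = 0"
    by simp
  then show "D (h p) = E (h p)"
    by simp
qed

lemma isometry_of_orthonormal:
  fixes h :: "nat \<Rightarrow> 'a::chilbert_space"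
  assumes h: "hilbert_basis h" and w: "orthonormal_on UNIV w"
  shows "\<exists>V V'. bounded_clinear V \<and> adjoint_pair V V' \<and> (\<forall>n. V (h n) = w n) \<and> (\<forall>x. V' (V x) = x)"
proof -
  obtain V V' where V: "bounded_clinear V" "adjoint_pair V V'" "\<And>n. V (h n) = w n"
    using operator_of_columns[OF h orthonormal_bounded_columns[OF w]] by blast
  have "(\<lambda>x. V' (V x)) = (\<lambda>x. x)"
  proof (rule bounded_clinear_eq_by_entries[OF h])
    show "bounded_clinear (\<lambda>x. V' (V x))"
      by (intro bounded_clinear_intros adjoint_bounded_clinear[OF V(2,1), THEN bounded_clinear_compose] V(1))
    show "cinner (V' (V (h p))) (h q) = cinner (h p) (h q)" for p q
      using h w V(3) by (simp add: adjoint_pairD'[OF V(2)] hilbert_basis_def orthonormal_on_def)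
  qed (rule bounded_clinear_ident)
  then have "\<forall>x. V' (V x) = x"
    by (simp add: fun_eq_iff)
  with V show ?thesis
    by blast
qed

lemma isometry_norms:
  assumes "adjoint_pair V V'" "\<And>x. V' (V x) = x"
  shows "norm (V x) = norm x" "norm (V' x) \<le> norm x"
proof -
  have V: "norm (V x) = norm x" for x
  proof -
    have "cinner (V x) (V x) = cinner x x"
      by (simp add: adjoint_pairD[OF assms(1)] assms(2))
    then show ?thesis
      unfolding cinner_self of_real_eq_iff by (simp add: power2_eq_iff_nonneg)
  qed
  then show "norm (V x) = norm x" .
  show "norm (V' x) \<le> norm x"
    using adjoint_bounded[OF assms(1), of 1 x] V by simp
qed

text \<open>The pair \<open>S0\<close>, \<open>S1\<close> identifies the space with two copies of itself, and it splits \<open>B\<close> as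
  \<open>B \<oplus> B\<close>. On the orthogonal complement of the range of \<open>V\<close> the unitary \<open>U\<close> is the embedding into the
  first copy. On the range of \<open>V\<close> it pulls back by \<open>V\<close>, splits the result by \<open>S0\<close> and \<open>S1\<close>, returns the
  first component by \<open>V\<close> to the first copy and sends the second component to the second copy. If \<open>T\<close>
  were exactly \<open>T' \<oplus> B\<close> with \<open>B\<close> acting on the range of \<open>V\<close>, this would intertwine \<open>T\<close> with
  \<open>T' \<oplus> B \<oplus> B = T \<oplus> B\<close>; in general each of the five uses of the intertwining relation costs \<open>\<epsilon>\<close>.\<close>
lemma absorption_unitary:
  fixes T B :: "'a::complex_inner \<Rightarrow> 'a"
  assumes lin: "bounded_clinear T" "bounded_clinear B" "bounded_clinear V"
      "bounded_clinear S0" "bounded_clinear S1"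
    and adj: "adjoint_pair V V'" "adjoint_pair S0 S0'" "adjoint_pair S1 S1'"
    and V: "\<And>x. V' (V x) = x"
    and S: "\<And>x. S0' (S0 x) = x" "\<And>x. S1' (S1 x) = x" "\<And>x. S0' (S1 x) = 0" "\<And>x. S1' (S0 x) = 0"
      "\<And>x. S0 (S0' x) + S1 (S1' x) = x"
    and SB: "\<And>x. S0' (B x) = B (S0' x)" "\<And>x. S1' (B x) = B (S1' x)"
    and small: "\<And>x. norm (T (V x) - V (B x)) \<le> \<epsilon> * norm x" "\<And>x. norm (V' (T x) - B (V' x)) \<le> \<epsilon> * norm x"
    and "0 \<le> \<epsilon>"
  shows "\<exists>U. unitary U \<and>
    (\<forall>x. norm (U (T x) - (S0 (T (S0' (U x))) + S1 (B (S1' (U x))))) \<le> 5 * \<epsilon> * norm x)"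
proof -
  have lin': "bounded_clinear V'" "bounded_clinear S0'" "bounded_clinear S1'"
    using adj lin adjoint_bounded_clinear by blast+
  note l = bounded_clinearD(2,3,6)[OF lin(1)] bounded_clinearD(2,3,6)[OF lin(2)]
    bounded_clinearD(2,3,6)[OF lin(3)] bounded_clinearD(2,3,6)[OF lin(4)] bounded_clinearD(2,3,6)[OF lin(5)]
    bounded_clinearD(2,3,6)[OF lin'(1)] bounded_clinearD(2,3,6)[OF lin'(2)] bounded_clinearD(2,3,6)[OF lin'(3)]
  define U where "U x = S0 (x - V (V' x) + V (S0' (V' x))) + S1 (S1' (V' x))" for x
  define U' where "U' y = (S0' y - V (V' (S0' y)) + V (S0 (V' (S0' y)))) + V (S1 (S1' y))" for y
  have "bounded_clinear U"
    unfolding U_def by (intro bounded_clinear_intros lin[THEN bounded_clinear_compose] lin'[THEN bounded_clinear_compose])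
  moreover have "cadjoint U = U'"
    by (intro cadjoint_eqI)
      (simp add: U_def U'_def cinner_simps adjoint_pairD[OF adj(1)] adjoint_pairD[OF adj(2)]
        adjoint_pairD[OF adj(3)] adjoint_pairD'[OF adj(1)] adjoint_pairD'[OF adj(2)] adjoint_pairD'[OF adj(3)])
  moreover have "U' (U x) = x" for x
  proof -
    define p where "p = x - V (V' x) + V (S0' (V' x))"
    have 1: "S0' (U x) = p" "S1' (U x) = S1' (V' x)"
      by (simp_all add: U_def p_def l S)
    have "V' p = S0' (V' x)"
      by (simp add: p_def l V)
    then have "U' (U x) = p - V (S0' (V' x)) + (V (S0 (S0' (V' x))) + V (S1 (S1' (V' x))))"
      by (simp add: U'_def 1 algebra_simps)
    also have "V (S0 (S0' (V' x))) + V (S1 (S1' (V' x))) = V (V' x)"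
      unfolding l(7)[symmetric] S(5) ..
    finally show ?thesis
      by (simp add: p_def)
  qed
  moreover have "U (U' y) = y" for y
  proof -
    define p where "p = S0' y"
    have "V' (U' y) = S0 (V' p) + S1 (S1' y)"
      by (simp add: U'_def p_def l V)
    then have "U (U' y) = S0 p + S1 (S1' y)"
      by (simp add: U_def l S) (simp add: U'_def p_def l)
    then show ?thesis
      by (simp add: p_def S(5))
  qed
  ultimately have "unitary U"
    unfolding unitary_def by (simp add: fun_eq_iff)
  moreover have "norm (U (T x) - (S0 (T (S0' (U x))) + S1 (B (S1' (U x))))) \<le> 5 * \<epsilon> * norm x" for x
  proof -
    define y where "y = V' x"
    define d where "d = V' (T x) - B y"
    define e where "e z = T (V z) - V (B z)" for z
    note nV = isometry_norms[OF adj(1) V] and n0 = isometry_norms[OF adj(2) S(1)]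
      and n1 = isometry_norms[OF adj(3) S(2)]
    have VT: "V' (T x) = B y + d" and TV: "T (V z) = V (B z) + e z" for z
      by (simp_all add: d_def e_def)
    have "U (T x) - (S0 (T (S0' (U x))) + S1 (B (S1' (U x)))) =
        (S0 (V (S0' d)) - S0 (V d)) + (S0 (e y) - S0 (e (S0' y))) + S1 (S1' d)"
      unfolding U_def y_def[symmetric] VT l S TV SB by (simp add: algebra_simps)
    also have "norm \<dots> \<le> (norm (S0 (V (S0' d))) + norm (S0 (V d)))
        + (norm (S0 (e y)) + norm (S0 (e (S0' y)))) + norm (S1 (S1' d))"
      by (intro order_trans[OF norm_triangle_ineq] add_mono norm_triangle_ineq4 order_refl)
    also have "\<dots> \<le> (norm d + norm d) + (norm (e y) + norm (e (S0' y))) + norm d"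
      using n0(2)[of d] n1(2)[of d] by (simp add: nV(1) n0(1) n1(1))
    also have "\<dots> \<le> (\<epsilon> * norm x + \<epsilon> * norm x) + (\<epsilon> * norm x + \<epsilon> * norm x) + \<epsilon> * norm x"
    proof -
      have "norm d \<le> \<epsilon> * norm x"
        using small(2)[of x] by (simp add: d_def y_def)
      moreover have "norm (e z) \<le> \<epsilon> * norm x" if "norm z \<le> norm x" for z
        unfolding e_def using small(1)[of z] mult_left_mono[OF that \<open>0 \<le> \<epsilon>\<close>] by linarith
      moreover have "norm y \<le> norm x" "norm (S0' y) \<le> norm x"
        using nV(2)[of x] n0(2)[of y] by (auto simp: y_def)
      ultimately show ?thesis
        by (intro add_mono) auto
    qed
    finally show ?thesis
      by simp
  qed
  ultimately show ?thesis
    by blast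
qed

lemma nat_pair_parity_cases:
  obtains i m where "n = prod_encode (i, 2 * m)" | i m where "n = prod_encode (i, 2 * m + 1)"
proof -
  obtain i k where n: "n = prod_encode (i, k)"
    by (metis prod.exhaust prod_decode_inverse)
  show ?thesis
  proof (cases "even k")
    case True
    then show ?thesis
      using that(1)[of i "k div 2"] n by simp
  next
    case False
    then show ?thesis
      using that(2)[of i "k div 2"] n by simp
  qed
qed

text \<open>\<open>C D C\<close> is linear and agrees with \<open>D\<close> on the real basis, and its adjoint is \<open>C E C\<close>.\<close>
lemma real_operator:
  fixes h :: "nat \<Rightarrow> 'a::chilbert_space"
  assumes C: "conjugation C" and h: "hilbert_basis h" "\<And>n. C (h n) = h n"
    and D: "bounded_clinear D" "\<And>n. C (D (h n)) = D (h n)" "adjoint_pair D E"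
  shows "C (D (C x)) = D x" "C (E (C x)) = E x"
proof -
  have eq: "(\<lambda>x. C (D (C x))) = D"
    by (rule bounded_clinear_eqI[OF h(1) bounded_clinear_conj[OF C D(1)] D(1)]) (simp add: h(2) D(2))
  then show "C (D (C x)) = D x"
    by (simp add: fun_eq_iff)
  have "adjoint_pair D (\<lambda>x. C (E (C x)))"
    using adjoint_pair_conj[OF C D(3)] eq by simp
  from adjoint_pair_unique[OF D(3) this] show "C (E (C x)) = E x"
    by metis
qed

section \<open>Complex symmetric operators are approximately equivalent to reducible ones\<close>

theorem theorem1p3:
  fixes T :: "'a::chilbert_space \<Rightarrow> 'a"
  assumes "\<not> (\<exists>B :: 'a set. finite B \<and> cspan B = UNIV)"
    and "separable_space (euclidean :: 'a topology)"
    and "bounded_clinear T"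
    and "complex_symmetric T"
  shows "\<exists>R :: 'a \<Rightarrow> 'a. bounded_clinear R \<and> complex_symmetric R \<and> reducible R \<and>
           approx_unitarily_equivalent T R"
proof -
  note lin = assms(3)
  obtain C where C: "conjugation C" and CTC: "C \<circ> T \<circ> C = cadjoint T"
    using assms(4) unfolding complex_symmetric_def by blast
  note cD = conjugationD[OF C]
  obtain h :: "nat \<Rightarrow> 'a" where h: "hilbert_basis h" and Ch: "\<And>n. C (h n) = h n"
    using real_hilbert_basis_exists[OF assms(1,2) C] by blast
  have onh: "orthonormal_on UNIV h"
    using h by (simp add: hilbert_basis_def)
  have adjT: "adjoint_pair T (C \<circ> T \<circ> C)"
    using adjoint_exists[OF h lin] cadjoint_eq CTC by metis
  obtain K where K: "0 \<le> K" "\<And>x. norm (T x) \<le> K * norm x"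
    using bounded_clinear_norm_bound[OF lin] by blast
  obtain u :: "nat \<Rightarrow> nat \<Rightarrow> 'a" and a :: "nat \<Rightarrow> nat \<Rightarrow> complex" where
    onu: "orthonormal_on {(k, i). i \<le> k} (\<lambda>(k, i). u k i)" and Cu: "\<And>k i. i \<le> k \<Longrightarrow> C (u k i) = u k i"
    and sym: "\<And>i j. a j i = a i j" and band: "\<And>i j. 2 * i + 2 < j \<Longrightarrow> a j i = 0"
    and err: "\<And>i. (\<lambda>k. norm (T (u k i) - (\<Sum>j\<le>2 * i + 2. a j i *\<^sub>C u k j))) \<longlonglongrightarrow> 0"
    and A: "\<And>z :: nat \<Rightarrow> 'a. orthonormal_on UNIV z \<Longrightarrow>
       bounded_columns K (\<lambda>i. \<Sum>j\<le>2 * i + 2. a j i *\<^sub>C z j)"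
    using limit_matrix[OF assms(1) C adjT lin K] by blast
  define H where "H p = h (prod_encode p)" for p
  have H: "cinner (H p) (H q) = (if p = q then 1 else 0)" for p q
    by (simp add: H_def onh[unfolded orthonormal_on_def] inj_eq[OF inj_prod_encode])
  have hH: "h n = H (prod_decode n)" for n
    by (simp add: H_def)
  have CH: "C (H p) = H p" for p
    by (simp add: H_def Ch)
  (* the second component of the index numbers the copies; doubling it with offset 0 or 1 splits the
     space into two copies of itself in a way that respects the copies of the limit matrix *)
  define sh where "sh b p = H (fst p, 2 * snd p + b)" for b and p :: "nat \<times> nat"
  have shift: "\<exists>S S'. bounded_clinear S \<and> adjoint_pair S S' \<and> (\<forall>n. S (h n) = sh b (prod_decode n)) \<and>
    (\<forall>x. S' (S x) = x)" for b
  proof (rule isometry_of_orthonormal[OF h])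
    have "inj (\<lambda>n. prod_encode (fst (prod_decode n), 2 * snd (prod_decode n) + b))"
    proof (rule injI)
      fix x y
      assume "prod_encode (fst (prod_decode x), 2 * snd (prod_decode x) + b)
        = prod_encode (fst (prod_decode y), 2 * snd (prod_decode y) + b)"
      then have "prod_decode x = prod_decode y"
        by (simp add: inj_eq[OF inj_prod_encode] prod_eq_iff)
      then show "x = y"
        by (simp add: inj_eq[OF inj_prod_decode])
    qed
    from orthonormal_on_comp_inj[OF onh this]
    show "orthonormal_on UNIV (\<lambda>n. sh b (prod_decode n))"
      by (simp add: sh_def H_def)
  qed
  obtain S0 S0' where S0: "bounded_clinear S0" "adjoint_pair S0 S0'"
    "\<And>n. S0 (h n) = sh 0 (prod_decode n)" "\<And>x. S0' (S0 x) = x"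
    using shift[of 0] by blast
  obtain S1 S1' where S1: "bounded_clinear S1" "adjoint_pair S1 S1'"
    "\<And>n. S1 (h n) = sh 1 (prod_decode n)" "\<And>x. S1' (S1 x) = x"
    using shift[of 1] by blast
  have S0': "bounded_clinear S0'" and S1': "bounded_clinear S1'"
    using adjoint_bounded_clinear S0 S1 by blast+
  have S0H: "S0 (H (i, m)) = H (i, 2 * m)" and S1H: "S1 (H (i, m)) = H (i, 2 * m + 1)" for i m
    using S0(3)[of "prod_encode (i, m)"] S1(3)[of "prod_encode (i, m)"] by (simp_all add: sh_def H_def)
  have "(\<lambda>x. S0' (S1 x)) = (\<lambda>x. 0)"
  proof (rule bounded_clinear_eq_by_entries[OF h])
    fix p q
    have "2 * k + 1 \<noteq> 2 * l" for k l :: nat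
      by presburger
    then show "cinner (S0' (S1 (h p))) (h q) = cinner 0 (h q)"
      by (simp add: adjoint_pairD'[OF S0(2)] S0(3) S1(3) sh_def H ci.zero_left)
  qed (intro bounded_clinear_intros S0'[THEN bounded_clinear_compose] S1(1))+
  then have S01: "S0' (S1 x) = 0" for x
    by (simp add: fun_eq_iff)
  have S10: "S1' (S0 x) = 0" for x
    by (rule cinner_ext) (metis S01 adjoint_pairD adjoint_pairD' S0(2) S1(2) ci.zero_left ci.zero_right)
  have "(\<lambda>x. S0 (S0' x) + S1 (S1' x)) = (\<lambda>x. x)"
  proof (rule bounded_clinear_eqI[OF h])
    fix n
    show "S0 (S0' (h n)) + S1 (S1' (h n)) = h n"
    proof (cases n rule: nat_pair_parity_cases)
      case (1 i m)
      then have "h n = S0 (H (i, m))"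
        unfolding S0H by (simp add: H_def)
      then show ?thesis
        by (simp add: S0(4) S10 bounded_clinearD(6)[OF S1(1)])
    next
      case (2 i m)
      then have "h n = S1 (H (i, m))"
        unfolding S1H by (simp add: H_def)
      then show ?thesis
        by (simp add: S1(4) S01 bounded_clinearD(6)[OF S0(1)])
    qed
  qed (intro bounded_clinear_intros S0(1)[THEN bounded_clinear_compose] S1(1)[THEN bounded_clinear_compose] S0' S1')+
  then have Ssum: "S0 (S0' x) + S1 (S1' x) = x" for x
    by (simp add: fun_eq_iff)
  have CS: "C (S0 (C x)) = S0 x" "C (S1 (C x)) = S1 x" "C (S0' (C x)) = S0' x" "C (S1' (C x)) = S1' x" for x
    using real_operator[OF C h Ch S0(1) _ S0(2)] real_operator[OF C h Ch S1(1) _ S1(2)]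
    by (simp_all add: S0(3) S1(3) sh_def CH)

  (* B is the limit matrix acting in every copy *)
  define Bcol where "Bcol p = (\<Sum>j\<le>2 * fst p + 2. a j (fst p) *\<^sub>C H (j, snd p))" for p :: "nat \<times> nat"
  have Bcol_H: "cinner (Bcol (i, m)) (H (j, m')) = (if m = m' then a j i else 0)" for i m j m'
  proof -
    have "cinner (Bcol (i, m)) (H (j, m')) = (\<Sum>k\<le>2 * i + 2. if k = j \<and> m = m' then a j i else 0)"
      unfolding Bcol_def ci.sum_left by (intro sum.cong) (auto simp: cinner_simps H)
    also have "\<dots> = (if m = m' then a j i else 0)"
      using band[of i j] by (cases "m = m'") (auto simp del: sum.atMost_Suc)
    finally show ?thesis .
  qed
  have "bounded_columns K Bcol"
  proof (rule bounded_columns_prod)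
    show "cinner (Bcol p) (Bcol q) = 0" if "snd p \<noteq> snd q" for p q
      unfolding Bcol_def ci.sum_left ci.sum_right using that
      by (intro sum.neutral ballI) (simp add: cinner_simps H)
    fix m
    have "orthonormal_on UNIV (\<lambda>j. H (j, m))"
      by (simp add: orthonormal_on_def H)
    from A[OF this] show "bounded_columns K (\<lambda>i. Bcol (i, m))"
      by (simp add: Bcol_def del: sum.atMost_Suc)
  qed
  then have "bounded_columns K (\<lambda>n. Bcol (prod_decode n))"
    using inj_prod_decode by (rule bounded_columns_comp_inj)
  then obtain B where B: "bounded_clinear B" "\<And>n. B (h n) = Bcol (prod_decode n)"
    using operator_of_columns[OF h] by blast
  have BH: "B (H p) = Bcol p" for p
    using B(2)[of "prod_encode p"] by (simp add: H_def)
  have adjB: "adjoint_pair B (\<lambda>x. C (B (C x)))"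
  proof (rule adjoint_pair_by_entries[OF h B(1) bounded_clinear_conj[OF C B(1)]])
    fix p q
    obtain i m j m' where pq: "prod_decode p = (i, m)" "prod_decode q = (j, m')"
      by fastforce
    have "cinner (h p) (C (B (C (h q)))) = cinner (B (h q)) (C (h p))"
      using cD(4)[of "C (h p)" "B (h q)"] by (simp add: Ch cD(3))
    also have "\<dots> = cinner (B (h p)) (h q)"
      using sym by (simp add: Ch) (simp add: hH pq BH Bcol_H)
    finally show "cinner (B (h p)) (h q) = cinner (h p) (C (B (C (h q))))" ..
  qed
  have "B (S0 (h n)) = S0 (B (h n))" "B (S1 (h n)) = S1 (B (h n))" for n
    by (cases "prod_decode n"; simp add: hH S0H S1H BH Bcol_def bounded_clinearD[OF S0(1)]
        bounded_clinearD[OF S1(1)] del: sum.atMost_Suc)+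
  then have "(\<lambda>x. B (S0 x)) = (\<lambda>x. S0 (B x))" "(\<lambda>x. B (S1 x)) = (\<lambda>x. S1 (B x))"
    using bounded_clinear_eqI[OF h bounded_clinear_compose[OF B(1) S0(1)] bounded_clinear_compose[OF S0(1) B(1)]]
      bounded_clinear_eqI[OF h bounded_clinear_compose[OF B(1) S1(1)] bounded_clinear_compose[OF S1(1) B(1)]]
    by blast+
  then have BS: "B (S0 x) = S0 (B x)" "B (S1 x) = S1 (B x)" for x
    by (simp_all add: fun_eq_iff)
  have SB: "S0' (B x) = B (S0' x)" "S1' (B x) = B (S1' x)" for x
  proof -
    have "B x = B (S0 (S0' x) + S1 (S1' x))"
      by (simp add: Ssum)
    then have "B x = S0 (B (S0' x)) + S1 (B (S1' x))"
      by (simp add: bounded_clinearD(2)[OF B(1)] BS)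
    then show "S0' (B x) = B (S0' x)" "S1' (B x) = B (S1' x)"
      by (simp_all add: bounded_clinearD(2)[OF S0'] bounded_clinearD(2)[OF S1'] S0(4) S1(4) S01 S10)
  qed

  (* R is the direct sum of T and B; the first copy reduces it *)
  define R where "R x = S0 (T (S0' x)) + S1 (B (S1' x))" for x
  have Rlin: "bounded_clinear R"
    unfolding R_def by (intro bounded_clinear_intros lin[THEN bounded_clinear_compose] B(1)[THEN bounded_clinear_compose] S0(1)[THEN bounded_clinear_compose] S1(1)[THEN bounded_clinear_compose] S0' S1')
  moreover have "complex_symmetric R"
  proof -
    have "C (R (C x)) = S0 (C (T (C (S0' x)))) + S1 (C (B (C (S1' x))))" for x
    proof -
      have "C (R (C x)) = C (S0 (C (C (T (C (C (S0' (C x)))))))) + C (S1 (C (C (B (C (C (S1' (C x))))))))"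
        by (simp add: R_def cD(1,3))
      then show ?thesis
        unfolding CS .
    qed
    then have "cinner (R x) y = cinner x ((C \<circ> R \<circ> C) y)" for x y
      using adjoint_pairD[OF adjT] by (simp add: R_def cinner_simps adjoint_pairD[OF adjB]
        adjoint_pairD[OF S0(2)] adjoint_pairD[OF S1(2)] adjoint_pairD'[OF S0(2)] adjoint_pairD'[OF S1(2)])
    then have "cadjoint R = C \<circ> R \<circ> C"
      by (rule cadjoint_eqI)
    then show ?thesis
      unfolding complex_symmetric_def using C by metis
  qed
  moreover have "reducible R"
    unfolding reducible_def
  proof (intro exI conjI)
    let ?P = "\<lambda>x. S0 (S0' x)"
    have "h 0 \<noteq> 0"
      using orthonormal_onD[OF onh, of 0 0] by (auto simp: ci.zero_left)
    have "bounded_clinear ?P"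
      by (intro S0(1)[THEN bounded_clinear_compose] S0')
    moreover have "cadjoint ?P = ?P"
      by (intro cadjoint_eqI) (simp add: adjoint_pairD[OF S0(2)] adjoint_pairD'[OF S0(2)])
    ultimately show "orthogonal_projection ?P"
      by (simp add: orthogonal_projection_def fun_eq_iff S0(4))
    show "?P \<noteq> (\<lambda>x. 0)"
      using S0(4) bounded_clinearD(6)[OF S0'] \<open>h 0 \<noteq> 0\<close> by metis
    show "?P \<noteq> id"
      using S1(4) S01 bounded_clinearD(6)[OF S0(1)] bounded_clinearD(6)[OF S1'] \<open>h 0 \<noteq> 0\<close> by (metis id_apply)
    show "?P \<circ> R = R \<circ> ?P"
      by (simp add: fun_eq_iff R_def bounded_clinearD(2)[OF S0'] S0(4) S01 S10
          bounded_clinearD(6)[OF S1(1)] bounded_clinearD(6)[OF B(1)])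
  qed
  moreover have "approx_unitarily_equivalent T R"
  proof -
    have "\<exists>U. unitary U \<and> (\<forall>x. norm (U (T x) - R (U x)) \<le> 5 * \<epsilon> * norm x)" if "\<epsilon> > 0" for \<epsilon>
    proof -
      have "\<exists>v :: nat \<times> nat \<Rightarrow> 'a. orthonormal_on UNIV v \<and> (\<forall>p. C (v p) = v p) \<and>
          bounded_columns \<epsilon> (\<lambda>(i, m). T (v (i, m)) - (\<Sum>j\<le>2 * i + 2. a j i *\<^sub>C v (j, m)))"
        by (rule approximate_intertwiner[OF C lin onu Cu sym band err A \<open>\<epsilon> > 0\<close>])
      then obtain v :: "nat \<times> nat \<Rightarrow> 'a" where onv: "orthonormal_on UNIV v" and Cv: "\<And>p. C (v p) = v p"
        and v: "bounded_columns \<epsilon> (\<lambda>(i, m). T (v (i, m)) - (\<Sum>j\<le>2 * i + 2. a j i *\<^sub>C v (j, m)))"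
        by blast
      have "orthonormal_on UNIV (\<lambda>n. v (prod_decode n))"
        using onv inj_prod_decode by (rule orthonormal_on_comp_inj)
      from isometry_of_orthonormal[OF h this]
      obtain V V' where V: "bounded_clinear V" "adjoint_pair V V'"
        "\<And>n. V (h n) = v (prod_decode n)" "\<And>x. V' (V x) = x"
        by blast
      have VH: "V (H p) = v p" for p
        using V(3)[of "prod_encode p"] by (simp add: H_def)
      have V': "bounded_clinear V'"
        using adjoint_bounded_clinear V by blast
      have CV: "C (V (C x)) = V x" for x
        using real_operator(1)[OF C h Ch V(1) _ V(2)] by (simp add: V(3) Cv)
      define X where "X x = T (V x) - V (B x)" for x
      have Xlin: "bounded_clinear X"
        unfolding X_def by (intro bounded_clinear_intros lin[THEN bounded_clinear_compose] V(1)[THEN bounded_clinear_compose] V(1) B(1))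
      have "X (H (i, m)) = T (v (i, m)) - (\<Sum>j\<le>2 * i + 2. a j i *\<^sub>C v (j, m))" for i m
        by (simp add: X_def VH BH Bcol_def bounded_clinearD[OF V(1)] del: sum.atMost_Suc)
      then have "(\<lambda>p. X (H p)) = (\<lambda>(i, m). T (v (i, m)) - (\<Sum>j\<le>2 * i + 2. a j i *\<^sub>C v (j, m)))"
        by (auto simp del: sum.atMost_Suc)
      with v have "bounded_columns \<epsilon> (\<lambda>p. X (H p))"
        by simp
      then have "bounded_columns \<epsilon> (\<lambda>n. X (h n))"
        using bounded_columns_comp_inj[OF _ inj_prod_decode, of \<epsilon> "\<lambda>p. X (H p)"] by (simp add: hH)
      then have X: "norm (X x) \<le> \<epsilon> * norm x" for x
        by (rule norm_le_of_bounded_columns[OF h Xlin])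
      (* V is real, so conjugating the error by C exchanges T and B with their adjoints; this bounds
         the error of the adjoint intertwining relation as well *)
      have "C (X (C x)) = C (T (C (C (V (C x))))) - C (V (C (C (B (C x)))))" for x
        by (simp add: X_def cD(3,6))
      then have "C (X (C x)) = C (T (C (V x))) - V (C (B (C x)))" for x
        unfolding CV .
      then have "adjoint_pair (\<lambda>x. C (X (C x))) (\<lambda>x. V' (T x) - B (V' x))"
        unfolding adjoint_pair_def using adjoint_pairD'[OF adjT] adjoint_pairD'[OF adjB]
        by (simp add: cinner_simps adjoint_pairD[OF V(2)])
      moreover have "norm (C (X (C x))) \<le> \<epsilon> * norm x" for x
        using X[of "C x"] by (simp add: cD(9))
      ultimately have "norm (V' (T x) - B (V' x)) \<le> \<epsilon> * norm x" for x
        by (rule adjoint_bounded)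
      then show ?thesis
        unfolding R_def
        using X \<open>\<epsilon> > 0\<close> by (intro absorption_unitary[OF lin B(1) V(1) S0(1) S1(1) V(2) S0(2) S1(2) V(4) S0(4) S1(4)
          S01 S10 Ssum SB]) (auto simp: X_def)
    qed
    then have "\<exists>U. unitary U \<and> (\<forall>x. norm (U (T x) - R (U x)) \<le> 5 * inverse (real (Suc n)) * norm x)" for n
      by simp
    then obtain U where U: "\<And>n. unitary (U n)"
      "\<And>n x. norm (U n (T x) - R (U n x)) \<le> 5 * inverse (real (Suc n)) * norm x"
      by metis
    have "(\<lambda>n. onorm (\<lambda>x. U n (T x) - R (U n x))) \<longlonglongrightarrow> 0"
    proof (rule tendsto_sandwich[OF always_eventually always_eventually tendsto_const])
      show "(\<lambda>n. 5 * inverse (real (Suc n))) \<longlonglongrightarrow> 0"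
        using tendsto_mult_right_zero[OF LIMSEQ_inverse_real_of_nat, of 5] by simp
      show "\<forall>n. onorm (\<lambda>x. U n (T x) - R (U n x)) \<le> 5 * inverse (real (Suc n))"
        by (intro allI onorm_bound U(2)) simp
      have "bounded_clinear (\<lambda>x. U n (T x) - R (U n x))" for n
        using U(1)[of n] lin Rlin unfolding unitary_def
        by (auto intro!: bounded_clinear_diff intro: bounded_clinear_compose[of "U n"] bounded_clinear_compose[of R])
      then show "\<forall>n. 0 \<le> onorm (\<lambda>x. U n (T x) - R (U n x))"
        using bounded_clinearD(1) onorm_pos_le by blast
    qed
    with U(1) show ?thesis
      unfolding approx_unitarily_equivalent_def by blast
  qed
  ultimately show ?thesis
    by blast
qed

end
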